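(* Let $n>75$ be even. (1) If there exist a Steiner quadruple system $S_{2n+2}$ of order $2n+2$ and a $3$-BBD$(n)$ $B_n$, then there exists a Steiner quadruple system $S_{8n+2}$ of order $8n+2$ such that (copies of) $S_{2n+2}$ and $B_n$ are contained in $S_{8n+2}$, i.e. the block sets of $S_{2n+2}$ and of $B_n$, placed on suitable subsets of the point set of $S_{8n+2}$ of sizes $2n+2$ and $n$ respectively, are subsets of the block set of $S_{8n+2}$. (2) If there exist an $S(3,\{4,6\},2n+2)$ design $S_{2n+2}$ and a $3$-BBD$(n)$ $B_n$, then there exists an $S(3,\{4,6\},8n+2)$ design $S_{8n+2}$ containing (copies of) $S_{2n+2}$ and $B_n$ in the same sense.
   Context: A Steiner quadruple system of order $v$, $S(3,4,v)$, is a pair $(X,B)$ with $|X|=v$ and $B$ a set of $4$-element subsets of $X$ such that every $3$-subset of $X$ lies in exactly one block. An $S(3,\{4,6\},v)$ is a pair $(X,B)$ with $|X|=v$ and $B$ a set of subsets of $X$ each of size $4$ or $6$, such that every $3$-subset of $X$ lies in exactly one block. A $3$-BBD$(n)$ is a triple $(X,\{g_1,g_2\},B)$ where $|X|=n$, $\{g_1,g_2\}$ is a partition of $X$ with $|g_1|=|g_2|$, and $B$ is a set of $4$-element subsets of $X$ with $|b\cap g_1|=|b\cap g_2|=2$ for all $b\in B$, such that every $3$-subset of $X$ meeting both $g_1$ and $g_2$ lies in exactly one block. *)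

theory Defs
  imports Main
begin

definition SQS :: "'a set \<Rightarrow> 'a set set \<Rightarrow> bool" where
  "SQS X B \<longleftrightarrow> finite X \<and> (\<forall>b\<in>B. b \<subseteq> X \<and> card b = 4) \<and>
     (\<forall>T. T \<subseteq> X \<and> card T = 3 \<longrightarrow> (\<exists>!b. b \<in> B \<and> T \<subseteq> b))"

definition S346 :: "'a set \<Rightarrow> 'a set set \<Rightarrow> bool" where
  "S346 X B \<longleftrightarrow> finite X \<and> (\<forall>b\<in>B. b \<subseteq> X \<and> (card b = 4 \<or> card b = 6)) \<and>
     (\<forall>T. T \<subseteq> X \<and> card T = 3 \<longrightarrow> (\<exists>!b. b \<in> B \<and> T \<subseteq> b))"

definition BBD3 :: "'a set \<Rightarrow> 'a set \<Rightarrow> 'a set \<Rightarrow> 'a set set \<Rightarrow> bool" where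
  "BBD3 X g1 g2 B \<longleftrightarrow> finite X \<and> g1 \<union> g2 = X \<and> g1 \<inter> g2 = {} \<and> card g1 = card g2 \<and>
     (\<forall>b\<in>B. b \<subseteq> X \<and> card b = 4 \<and> card (b \<inter> g1) = 2 \<and> card (b \<inter> g2) = 2) \<and>
     (\<forall>T. T \<subseteq> X \<and> card T = 3 \<and> T \<inter> g1 \<noteq> {} \<and> T \<inter> g2 \<noteq> {} \<longrightarrow>
        (\<exists>!b. b \<in> B \<and> T \<subseteq> b))"

definition embeds :: "'a set \<Rightarrow> 'a set set \<Rightarrow> 'c set \<Rightarrow> 'c set set \<Rightarrow> bool" where
  "embeds X B Z D \<longleftrightarrow> (\<exists>f. inj_on f X \<and> f ` X \<subseteq> Z \<and> (\<lambda>b. f ` b) ` B \<subseteq> D)"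

end

theory Submission
  imports Defs
begin

text \<open>
  Put \<open>m = 2n\<close>. The points are four layers \<open>\<int>/m\<close> and two points at infinity. On each layer together
  with infinity we place a copy of \<open>S\<close>, and on layers 0, 3 and on layers 1, 2 a balanced design with
  groups of size \<open>m\<close> that arises from \<open>B\<close> by doubling twice. Every other triple lies in a mixed block:
  \<^item> \<open>{x, x', y, z}\<close> with \<open>x \<noteq> x'\<close> in layer \<open>p\<close>, \<open>y\<close> in layer \<open>q\<close>, \<open>z\<close> in layer \<open>r\<close> and \<open>x + x' = y + z + c\<close>;
  \<^item> \<open>{\<infinity>, x, y, z}\<close> with \<open>2x = y + z + c\<close>,

  where \<open>(p; q, r; c)\<close> is one of \<open>(0; 1, 2; 0)\<close>, \<open>(1; 0, 3; 0)\<close>, \<open>(2; 0, 3; 1)\<close>, \<open>(3; 1, 2; -1)\<close>. A transversal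
  triple is of the second kind exactly when the partner \<open>x'\<close> would coincide with \<open>x\<close>. The two solutions
  \<open>x\<close>, \<open>x + m/2\<close> of \<open>2x = y + z + c\<close> go to different infinite points; the parities of the constants make
  the two families on a pair such as layers 0, 3 complementary, and since the constants add up to zero
  the choice of the infinite point can be made consistently on all pairs of layers.
\<close>

subsection \<open>Residues\<close>

lemma residue_unique:
  fixes m :: int
  assumes "x \<in> {0..<m}" "y \<in> {0..<m}" "m dvd x - y"
  shows "x = y"
  using assms by (metis atLeastLessThan_iff mod_eq_dvd_iff mod_pos_pos_trivial)

lemma residue_exists:
  fixes m :: int
  assumes "0 < m"
  shows "\<exists>x\<in>{0..<m}. m dvd a - x"
  using assms by (intro bexI[of _ "a mod m"]) (auto simp: mod_eq_dvd_iff[symmetric])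

lemma residue_ex1:
  fixes m :: int
  assumes "0 < m"
  shows "\<exists>!x. x \<in> {0..<m} \<and> m dvd a - x"
proof -
  obtain x where x: "x \<in> {0..<m}" "m dvd a - x" using residue_exists[OF assms] by blast
  have "y = x" if "y \<in> {0..<m}" "m dvd a - y" for y
  proof (rule residue_unique[OF that(1) x(1)])
    show "m dvd y - x" using dvd_diff[OF x(2) that(2)] by simp
  qed
  with x show ?thesis by blast
qed

text \<open>This is the rule that separates a residue from its antipode: for even \<open>m\<close>,
  exactly one of \<open>d\<close> and \<open>d + m div 2\<close> falls in the first half of the
  residues. It later decides which infinite point completes a block.\<close>

definition lower_half :: "int \<Rightarrow> int \<Rightarrow> bool" where
  "lower_half m d \<longleftrightarrow> d mod m < m div 2"

lemma lower_half_cong: "m dvd a - b \<Longrightarrow> lower_half m a = lower_half m b"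
  by (simp add: lower_half_def mod_eq_dvd_iff[symmetric])

lemma lower_half_shift:
  assumes "even m" "0 < m"
  shows "lower_half m (d + m div 2) \<longleftrightarrow> \<not> lower_half m d"
proof -
  obtain h where m: "m = 2 * h" using assms by blast
  define r where "r = d mod m"
  have r: "0 \<le> r" "r < 2 * h" using assms m by (auto simp: r_def)
  have "(d + h) mod m = (r + h) mod m" by (simp add: r_def mod_simps)
  also have "\<dots> = (if r < h then r + h else r - h)"
  proof (cases "r < h")
    case True then show ?thesis using r m by simp
  next
    case False
    have "(r + h) mod m = (r - h + m) mod m" using m by (simp add: algebra_simps)
    also have "\<dots> = (r - h) mod m" by simp
    also have "\<dots> = r - h" using False r m by simp
    finally show ?thesis using False by simp
  qed
  finally show ?thesis using r m by (auto simp: lower_half_def r_def)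
qed

text \<open>Modulo an even \<open>m\<close>, an even \<open>a\<close> has exactly two halves, which
  differ by \<open>m div 2\<close>. A predicate that flips under this shift holds at one of them and
  fails at the other, so prescribing its value \<open>h\<close> singles out one half.\<close>

lemma halving_ex1:
  fixes m :: int
  assumes m: "even m" "0 < m" and a: "even a"
    and flip: "\<And>x y. m dvd y - (x + m div 2) \<Longrightarrow> P y \<longleftrightarrow> \<not> P x"
  shows "\<exists>!x. x \<in> {0..<m} \<and> m dvd 2 * x - a \<and> P x = h"
proof -
  obtain k where k: "m = 2 * k" using m by blast
  obtain e where e: "a = 2 * e" using a by blast
  have dvd: "m dvd 2 * x - a \<longleftrightarrow> k dvd x - e" for x
    using k e by (metis mult_dvd_mono dvd_times_left_cancel_iff right_diff_distrib' zero_neq_numeral)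
  obtain x where x: "x \<in> {0..<m}" "m dvd e - x" using residue_exists[OF m(2)] by blast
  obtain y where y: "y \<in> {0..<m}" "m dvd (e + k) - y" using residue_exists[OF m(2)] by blast
  have kx: "k dvd x - e" and ky: "k dvd y - e"
  proof -
    have "k dvd e - x" "k dvd (e + k) - y" using x(2) y(2) k by (meson dvd_trans dvd_triv_right)+
    then show "k dvd x - e" by (metis dvd_minus_iff minus_diff_eq)
    have "k dvd k - ((e + k) - y)" using dvd_diff[OF dvd_refl \<open>k dvd (e + k) - y\<close>] .
    then show "k dvd y - e" by simp
  qed
  have "m dvd (e - x) - ((e + k) - y)" using x(2) y(2) by (rule dvd_diff)
  then have PF: "P y \<longleftrightarrow> \<not> P x" using flip[of y x] k by (simp add: algebra_simps)
  have only: "u = x \<or> u = y" if u: "u \<in> {0..<m}" "k dvd u - e" for u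
  proof -
    \<comment> \<open>The parity of the quotient \<open>j\<close> tells the two solutions modulo
      \<open>m\<close> apart: even gives \<open>e\<close>, odd gives \<open>e + k\<close>.\<close>
    obtain j where j: "u - e = k * j" using u by blast
    show ?thesis
    proof (cases "even j")
      case True
      then obtain i where "j = 2 * i" by blast
      then have "m dvd u - e" using j k by simp
      then have "m dvd (u - e) + (e - x)" using x(2) by (rule dvd_add)
      then have "u = x" using residue_unique[OF u(1) x(1)] by simp
      then show ?thesis ..
    next
      case False
      then obtain i where "j = 2 * i + 1" by (elim oddE)
      then have "u - (e + k) = m * i" using j k by (simp add: algebra_simps)
      then have "m dvd u - (e + k)" by simp
      then have "m dvd (u - (e + k)) + ((e + k) - y)" using y(2) by (rule dvd_add)
      then have "u = y" using residue_unique[OF u(1) y(1)] by simp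
      then show ?thesis ..
    qed
  qed
  show ?thesis unfolding dvd
  proof (cases "P x = h")
    case True
    then show "\<exists>!x. x \<in> {0..<m} \<and> k dvd x - e \<and> P x = h"
      using x kx only PF by (intro ex1I[of _ x]) blast+
  next
    case False
    then show "\<exists>!x. x \<in> {0..<m} \<and> k dvd x - e \<and> P x = h"
      using y ky only PF by (intro ex1I[of _ y]) blast+
  qed
qed

subsection \<open>Three-element sets\<close>

lemma card_3_subset_of_4:
  assumes "T \<subseteq> {a, b, c, d}" "card T = 3"
  shows "T = {a, b, c} \<or> T = {a, b, d} \<or> T = {a, c, d} \<or> T = {b, c, d}"
proof -
  obtain x y z where xyz: "T = {x, y, z}" "x \<noteq> y" "y \<noteq> z" "x \<noteq> z"
    using assms(2) by (auto simp: card_3_iff)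
  have "x \<in> {a,b,c,d}" "y \<in> {a,b,c,d}" "z \<in> {a,b,c,d}" using assms xyz by auto
  then show ?thesis using xyz by (auto simp: insert_commute)
qed

text \<open>Serves as a without-loss-of-generality principle: the points of a triple may be listed
  by group or by layer, which cuts down the case distinctions below.\<close>

lemma card_3_sorted:
  fixes f :: "'a \<Rightarrow> 'b :: linorder"
  assumes "card T = 3"
  obtains a b c where "T = {a, b, c}" "a \<noteq> b" "b \<noteq> c" "a \<noteq> c" "f a \<le> f b" "f b \<le> f c"
proof -
  obtain x y z where xyz: "T = {x, y, z}" "x \<noteq> y" "y \<noteq> z" "x \<noteq> z"
    using assms by (auto simp: card_3_iff)
  have perms: "T = {x, z, y}" "T = {y, x, z}" "T = {y, z, x}" "T = {z, x, y}" "T = {z, y, x}"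
    using xyz(1) by auto
  consider "f x \<le> f y" "f y \<le> f z" | "f x \<le> f z" "f z \<le> f y" | "f y \<le> f x" "f x \<le> f z"
    | "f y \<le> f z" "f z \<le> f x" | "f z \<le> f x" "f x \<le> f y" | "f z \<le> f y" "f y \<le> f x"
    by (meson linear)
  then show thesis
    by cases (use that xyz perms in \<open>metis\<close>)+
qed

lemma ex1_block_image:
  assumes f: "inj_on f X" and B: "\<And>b. b \<in> B \<Longrightarrow> b \<subseteq> X" and T: "T \<subseteq> X"
    and ex1: "\<exists>!b. b \<in> B \<and> T \<subseteq> b"
  shows "\<exists>!b. b \<in> (`) f ` B \<and> f ` T \<subseteq> b"
proof -
  have "f ` T \<subseteq> f ` b \<longleftrightarrow> T \<subseteq> b" if "b \<in> B" for b
    using inj_on_image_mem_iff[OF f _ B[OF that]] T by (metis image_mono image_subset_iff subset_iff)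
  with ex1 show ?thesis by (smt (verit) imageE imageI)
qed

subsection \<open>Steiner systems with prescribed block sizes\<close>

text \<open>Treats both parts of the theorem at once: \<open>K\<close> is \<open>{4}\<close> for
  quadruple systems and \<open>{4, 6}\<close> for the other designs. All blocks added by the
  construction have size 4, so only \<open>4 \<in> K\<close> will matter.\<close>

definition steiner3 :: "nat set \<Rightarrow> 'a set \<Rightarrow> 'a set set \<Rightarrow> bool" where
  "steiner3 K X B \<longleftrightarrow> finite X \<and> (\<forall>b\<in>B. b \<subseteq> X \<and> card b \<in> K) \<and>
     (\<forall>T. T \<subseteq> X \<and> card T = 3 \<longrightarrow> (\<exists>!b. b \<in> B \<and> T \<subseteq> b))"

lemma SQS_iff_steiner3: "SQS X B \<longleftrightarrow> steiner3 {4} X B"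
  by (simp add: SQS_def steiner3_def)

lemma S346_iff_steiner3: "S346 X B \<longleftrightarrow> steiner3 {4, 6} X B"
  by (simp add: S346_def steiner3_def)

lemma steiner3_image:
  assumes S: "steiner3 K X B" and f: "inj_on f X"
  shows "steiner3 K (f ` X) ((`) f ` B)"
  unfolding steiner3_def
proof (intro conjI allI impI ballI)
  show "finite (f ` X)" using S by (simp add: steiner3_def)
next
  fix b assume "b \<in> (`) f ` B"
  then obtain b' where b: "b = f ` b'" "b' \<in> B" by auto
  then have b': "b' \<subseteq> X" "card b' \<in> K" using S by (auto simp: steiner3_def)
  show "b \<subseteq> f ` X" using b b' by blast
  show "card b \<in> K" using b b' f by (metis card_image inj_on_subset)
next
  fix T assume T: "T \<subseteq> f ` X \<and> card T = 3"
  then obtain T' where T': "T' \<subseteq> X" "T = f ` T'" by (meson subset_image_iff)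
  then have "card T' = 3" using T f by (metis card_image inj_on_subset)
  then have "\<exists>!b. b \<in> B \<and> T' \<subseteq> b" using S T' by (auto simp: steiner3_def)
  then show "\<exists>!b. b \<in> (`) f ` B \<and> T \<subseteq> b"
    unfolding T'(2) using S by (intro ex1_block_image[OF f _ T'(1)]) (auto simp: steiner3_def)
qed

subsection \<open>Balanced designs on two groups\<close>

lemma BBD3_sym: "BBD3 Y g1 g2 C \<Longrightarrow> BBD3 Y g2 g1 C"
  by (auto simp: BBD3_def)

lemma BBD3_image:
  assumes S: "BBD3 Y g1 g2 C" and f: "inj_on f Y"
  shows "BBD3 (f ` Y) (f ` g1) (f ` g2) ((`) f ` C)"
proof -
  have g: "g1 \<union> g2 = Y" "g1 \<inter> g2 = {}" "card g1 = card g2" "finite Y"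
    using S by (auto simp: BBD3_def)
  have sub: "g1 \<subseteq> Y" "g2 \<subseteq> Y" using g by auto
  have C: "b \<subseteq> Y" "card b = 4" "card (b \<inter> g1) = 2" "card (b \<inter> g2) = 2" if "b \<in> C" for b
    using S that by (auto simp: BBD3_def)
  have cd: "card (f ` A) = card A" if "A \<subseteq> Y" for A
    using f that by (meson card_image inj_on_subset)
  have int: "f ` A \<inter> f ` A' = f ` (A \<inter> A')" if "A \<subseteq> Y" "A' \<subseteq> Y" for A A'
    using f that by (metis inj_on_image_Int)
  show ?thesis unfolding BBD3_def
  proof (intro conjI allI impI ballI)
    show "f ` g1 \<union> f ` g2 = f ` Y" using g by blast
    show "f ` g1 \<inter> f ` g2 = {}" using int[OF sub] g by simp
    show "card (f ` g1) = card (f ` g2)" using cd sub g by simp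
    show "finite (f ` Y)" using g by simp
  next
    fix b assume "b \<in> (`) f ` C"
    then obtain b' where b: "b = f ` b'" "b' \<in> C" by auto
    note c = C[OF b(2)]
    show "b \<subseteq> f ` Y" using b c by blast
    show "card b = 4" using b c cd by simp
    have "b' \<inter> g1 \<subseteq> Y" "b' \<inter> g2 \<subseteq> Y" using c by auto
    then show "card (b \<inter> f ` g1) = 2" "card (b \<inter> f ` g2) = 2"
      unfolding b using int c sub cd by metis+
  next
    fix T assume T: "T \<subseteq> f ` Y \<and> card T = 3 \<and> T \<inter> f ` g1 \<noteq> {} \<and> T \<inter> f ` g2 \<noteq> {}"
    then obtain T' where T': "T' \<subseteq> Y" "T = f ` T'" by (meson subset_image_iff)
    have "card T' = 3" "T' \<inter> g1 \<noteq> {}" "T' \<inter> g2 \<noteq> {}" using T T' cd int sub by auto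
    then have "\<exists>!b. b \<in> C \<and> T' \<subseteq> b" using S T' by (auto simp: BBD3_def)
    then show "\<exists>!b. b \<in> (`) f ` C \<and> T \<subseteq> b"
      unfolding T'(2) by (intro ex1_block_image[OF f _ T'(1)]) (auto simp: C)
  qed
qed

lemma BBD3_ex1:
  assumes "BBD3 Y g1 g2 C" "T \<subseteq> Y" "card T = 3" "T \<inter> g1 \<noteq> {}" "T \<inter> g2 \<noteq> {}"
  shows "\<exists>!b. b \<in> C \<and> T \<subseteq> b"
  using assms by (simp add: BBD3_def)

section \<open>Doubling a balanced design: tagged lifts of old blocks, and zero-sum blocks across
  the tags\<close>

definition lifted_blocks :: "'a set \<Rightarrow> 'a set \<Rightarrow> 'a set set \<Rightarrow> (bool \<times> 'a) set set" where
  "lifted_blocks g1 g2 C =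
     {(\<lambda>y. (w y, y)) ` b | w b. b \<in> C \<and> (\<forall>y\<in>b \<inter> g1. \<forall>y'\<in>b \<inter> g1. w y = w y') \<and>
        (\<forall>y\<in>b \<inter> g2. \<forall>y'\<in>b \<inter> g2. w y = w y')}"

text \<open>Complements \<open>lifted_blocks\<close>, where the two points of a block in one group
  always carry equal tags. Here they carry different tags, and the labels \<open>e\<close> sum to
  zero modulo the group size \<open>s\<close>. The case \<open>a = a'\<close> is included, so that
  both copies of one point also occur together.\<close>

definition cross_blocks :: "('a \<Rightarrow> int) \<Rightarrow> int \<Rightarrow> 'a set \<Rightarrow> 'a set \<Rightarrow> (bool \<times> 'a) set set" where
  "cross_blocks e s g1 g2 =
     {{(False, a), (True, a'), (False, c), (True, d)} | a a' c d.
        a \<in> g1 \<and> a' \<in> g1 \<and> c \<in> g2 \<and> d \<in> g2 \<and> s dvd e a + e a' + e c + e d}"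

lemma lifted_blocksI:
  assumes "b \<in> C" "\<And>y y'. \<lbrakk>y \<in> b; y' \<in> b; y \<in> g1; y' \<in> g1\<rbrakk> \<Longrightarrow> w y = w y'"
    "\<And>y y'. \<lbrakk>y \<in> b; y' \<in> b; y \<in> g2; y' \<in> g2\<rbrakk> \<Longrightarrow> w y = w y'"
  shows "(\<lambda>y. (w y, y)) ` b \<in> lifted_blocks g1 g2 C"
  using assms unfolding lifted_blocks_def by blast

lemma lifted_blocks_sym: "lifted_blocks g1 g2 C = lifted_blocks g2 g1 C"
  unfolding lifted_blocks_def by (simp add: conj_commute)

lemma cross_blocks_sym: "cross_blocks e s g1 g2 = cross_blocks e s g2 g1"
proof -
  have "cross_blocks e s g1 g2 \<subseteq> cross_blocks e s g2 g1" for g1 g2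
  proof
    fix b assume "b \<in> cross_blocks e s g1 g2"
    then obtain a a' c d where *: "b = {(False, a), (True, a'), (False, c), (True, d)}"
      "a \<in> g1" "a' \<in> g1" "c \<in> g2" "d \<in> g2" "s dvd e a + e a' + e c + e d"
      unfolding cross_blocks_def by blast
    have "b = {(False, c), (True, d), (False, a), (True, a')}" using *(1) by auto
    moreover have "s dvd e c + e d + e a + e a'" using *(6) by (simp add: algebra_simps)
    ultimately show "b \<in> cross_blocks e s g2 g1" using * unfolding cross_blocks_def by blast
  qed
  then show ?thesis by (intro antisym)
qed

text \<open>Any three labels of a zero-sum block force the fourth, and \<open>e\<close> turns that
  residue back into a point of the group.\<close>

lemma residue_bij_ex1:
  fixes s :: int
  assumes e: "bij_betw e g {0..<s}" and s: "0 < s"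
  shows "\<exists>!d. d \<in> g \<and> s dvd k + e d"
proof -
  from residue_ex1[OF s, of "- k"] obtain x where x: "x \<in> {0..<s} \<and> s dvd - k - x"
    "\<forall>y. y \<in> {0..<s} \<and> s dvd - k - y \<longrightarrow> y = x" by (rule ex1E)
  have iff: "s dvd k + y \<longleftrightarrow> s dvd - k - y" for y
    using dvd_minus_iff[of s "k + y"] by simp
  obtain d where d: "d \<in> g" "e d = x" using e x(1) unfolding bij_betw_def by (metis imageE)
  show ?thesis
  proof (rule ex1I[of _ d])
    show "d \<in> g \<and> s dvd k + e d" unfolding iff using d x(1) by simp
    fix d' assume d': "d' \<in> g \<and> s dvd k + e d'"
    then have "e d' = x" using x(2) e iff by (meson bij_betwE)
    then show "d' = d" using d d' e by (metis bij_betw_imp_inj_on inj_onD)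
  qed
qed

text \<open>The tags of the two points in \<open>g1\<close> decide the kind of block. Equal tags
  force a lift of the unique old block through the underlying triple; different tags force a cross
  block, whose fourth point has the tag opposite to \<open>v\<close> and is determined by the sum
  condition.\<close>

lemma doubled_blocks_ex1:
  assumes D: "BBD3 Y g1 g2 C" and e: "bij_betw e g1 {0..<s}" "bij_betw e g2 {0..<s}"
    and a: "a \<in> g1" "a' \<in> g1" "c \<in> g2" "(u, a) \<noteq> (u', a')"
  shows "\<exists>!b. b \<in> (lifted_blocks g1 g2 C \<union> cross_blocks e s g1 g2) \<and> {(u, a), (u', a'), (v, c)} \<subseteq> b"
proof -
  have g: "g1 \<union> g2 = Y" "g1 \<inter> g2 = {}" using D by (auto simp: BBD3_def)
  have C: "b \<subseteq> Y" if "b \<in> C" for b using D that by (auto simp: BBD3_def)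
  have s: "0 < s" using e a by (metis atLeastLessThan_iff bij_betwE le_less_trans)
  show ?thesis
  proof (cases "u = u'")
    case u: True
    then have "a \<noteq> a'" "a \<noteq> c" "a' \<noteq> c" using a g by auto
    then have "card {a, a', c} = 3" by simp
    then have "\<exists>!b. b \<in> C \<and> {a, a', c} \<subseteq> b"
      using a g by (intro BBD3_ex1[OF D]) auto
    then obtain b where b: "b \<in> C \<and> {a, a', c} \<subseteq> b" "\<forall>b'. b' \<in> C \<and> {a, a', c} \<subseteq> b' \<longrightarrow> b' = b"
      by (rule ex1E)
    \<comment> \<open>On the block, the tag is \<open>u\<close> throughout its part in
      \<open>g1\<close> and \<open>v\<close> throughout its part in \<open>g2\<close>; the triple
      leaves no other choice.\<close>
    let ?w = "\<lambda>y. if y \<in> g1 then u else v"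
    show ?thesis
    proof (rule ex1I[of _ "(\<lambda>y. (?w y, y)) ` b"], intro conjI)
      show "(\<lambda>y. (?w y, y)) ` b \<in> (lifted_blocks g1 g2 C \<union> cross_blocks e s g1 g2)"
        using b(1) g(2) by (intro UnI1 lifted_blocksI) (auto 0 0 simp: disjoint_iff)
      show "{(u, a), (u', a'), (v, c)} \<subseteq> (\<lambda>y. (?w y, y)) ` b" 
      proof -
        have "c \<notin> g1" using a g by auto
        then show ?thesis using b(1) a u by (auto simp: image_iff)
      qed
      fix b' assume b': "b' \<in> (lifted_blocks g1 g2 C \<union> cross_blocks e s g1 g2) \<and> {(u, a), (u', a'), (v, c)} \<subseteq> b'"
      have "b' \<notin> cross_blocks e s g1 g2"
        using b' u a g unfolding cross_blocks_def by auto
      then have "b' \<in> lifted_blocks g1 g2 C" using b' by blast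
      then obtain w b1 where w: "b' = (\<lambda>y. (w y, y)) ` b1" "b1 \<in> C"
        "\<forall>y\<in>b1 \<inter> g1. \<forall>y'\<in>b1 \<inter> g1. w y = w y'" "\<forall>y\<in>b1 \<inter> g2. \<forall>y'\<in>b1 \<inter> g2. w y = w y'"
        unfolding lifted_blocks_def by blast
      have in1: "{a, a', c} \<subseteq> b1" "w a = u" "w c = v" using b' w(1) by auto
      then have "b1 = b" using b(2) w(2) by blast
      moreover have "w y = ?w y" if "y \<in> b1" for y
        using that in1 w(3,4) a g C[OF w(2)] by (metis IntI UnE insert_subset subsetD)
      ultimately show "b' = (\<lambda>y. (?w y, y)) ` b" using w(1) by auto
    qed
  next
    case u: False
    \<comment> \<open>Renames the two points so that \<open>x\<close> is the one tagged
      \<open>False\<close>, in the order in which \<open>cross_blocks\<close> lists them.\<close>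
    define x x' where "x = (if u then a' else a)" and "x' = (if u then a else a')"
    have T: "{(u, a), (u', a'), (v, c)} = {(False, x), (True, x'), (v, c)}"
      using u by (auto simp: x_def x'_def)
    have x: "x \<in> g1" "x' \<in> g1" using a by (auto simp: x_def x'_def)
    have form: "\<exists>y z. b = {(False, x), (True, x'), (False, y), (True, z)} \<and> y \<in> g2 \<and> z \<in> g2 \<and>
         s dvd e x + e x' + e y + e z \<and> c = (if v then z else y)"
      if "b \<in> (lifted_blocks g1 g2 C \<union> cross_blocks e s g1 g2)" "{(False, x), (True, x'), (v, c)} \<subseteq> b" for b
    proof -
      have "b \<notin> lifted_blocks g1 g2 C" using that x unfolding lifted_blocks_def by auto
      then have "b \<in> cross_blocks e s g1 g2" using that by blast
      then show ?thesis using that(2) x a g unfolding cross_blocks_def by (cases v) auto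
    qed
    show ?thesis unfolding T
    proof (cases v)
      case True
      from residue_bij_ex1[OF e(2) s] obtain y where y: "y \<in> g2 \<and> s dvd (e x + e x' + e c) + e y"
        "\<forall>y'. y' \<in> g2 \<and> s dvd (e x + e x' + e c) + e y' \<longrightarrow> y' = y"
        by (rule ex1E)
      show "\<exists>!b. b \<in> (lifted_blocks g1 g2 C \<union> cross_blocks e s g1 g2) \<and> {(False, x), (True, x'), (v, c)} \<subseteq> b"
      proof (rule ex1I[of _ "{(False, x), (True, x'), (False, y), (True, c)}"])
        have "s dvd e x + e x' + e y + e c" using y(1) by (simp add: algebra_simps)
        then show "{(False, x), (True, x'), (False, y), (True, c)} \<in> (lifted_blocks g1 g2 C \<union> cross_blocks e s g1 g2) \<and>
           {(False, x), (True, x'), (v, c)} \<subseteq> {(False, x), (True, x'), (False, y), (True, c)}"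
          using x y(1) a True unfolding cross_blocks_def by auto
      next
        fix b assume b: "b \<in> (lifted_blocks g1 g2 C \<union> cross_blocks e s g1 g2) \<and> {(False, x), (True, x'), (v, c)} \<subseteq> b"
        obtain y' where y': "b = {(False, x), (True, x'), (False, y'), (True, c)}" "y' \<in> g2"
          "s dvd e x + e x' + e y' + e c" using form[of b] b True by auto
        have "s dvd (e x + e x' + e c) + e y'" using y'(3) by (simp add: algebra_simps)
        then show "b = {(False, x), (True, x'), (False, y), (True, c)}" using y' y(2) by blast
      qed
    next
      case False
      from residue_bij_ex1[OF e(2) s] obtain y where y: "y \<in> g2 \<and> s dvd (e x + e x' + e c) + e y"
        "\<forall>y'. y' \<in> g2 \<and> s dvd (e x + e x' + e c) + e y' \<longrightarrow> y' = y"
        by (rule ex1E)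
      show "\<exists>!b. b \<in> (lifted_blocks g1 g2 C \<union> cross_blocks e s g1 g2) \<and> {(False, x), (True, x'), (v, c)} \<subseteq> b"
      proof (rule ex1I[of _ "{(False, x), (True, x'), (False, c), (True, y)}"])
        show "{(False, x), (True, x'), (False, c), (True, y)} \<in> (lifted_blocks g1 g2 C \<union> cross_blocks e s g1 g2) \<and>
           {(False, x), (True, x'), (v, c)} \<subseteq> {(False, x), (True, x'), (False, c), (True, y)}"
          using x y(1) a False unfolding cross_blocks_def by auto
      next
        fix b assume b: "b \<in> (lifted_blocks g1 g2 C \<union> cross_blocks e s g1 g2) \<and> {(False, x), (True, x'), (v, c)} \<subseteq> b"
        obtain y' where y': "b = {(False, x), (True, x'), (False, c), (True, y')}" "y' \<in> g2"
          "s dvd e x + e x' + e c + e y'" using form[of b] b False by auto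
        then show "b = {(False, x), (True, x'), (False, c), (True, y)}" using y(2) by blast
      qed
    qed
  qed
qed

text \<open>Both groups double in size, and the old design survives as the lifts with all tags
  \<open>False\<close>.\<close>

lemma BBD3_double:
  fixes Y :: "'a set"
  assumes D: "BBD3 Y g1 g2 C"
  obtains C' where "BBD3 (UNIV \<times> Y) (UNIV \<times> g1) (UNIV \<times> g2) (C' :: (bool \<times> 'a) set set)"
    "embeds Y C (UNIV \<times> Y) C'"
proof -
  have g: "g1 \<union> g2 = Y" "g1 \<inter> g2 = {}" "card g1 = card g2" "finite Y" using D by (auto simp: BBD3_def)
  have fin: "finite g1" "finite g2" using g by (metis finite_Un)+
  have C: "b \<subseteq> Y" "card b = 4" "card (b \<inter> g1) = 2" "card (b \<inter> g2) = 2" if "b \<in> C" for b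
    using D that by (auto simp: BBD3_def)
  define s where "s = int (card g1)"
  have "\<exists>f. bij_betw f g {0..<s}" if "finite g" "card g = card g1" for g :: "'a set"
    using that by (intro finite_same_card_bij) (auto simp: s_def)
  then obtain e1 e2 where "bij_betw e1 g1 {0..<s}" "bij_betw e2 g2 {0..<s}" using fin g by metis
  \<comment> \<open>The two labellings live on disjoint groups, so they merge into a single function
    that is a bijection onto the residues on each group.\<close>
  moreover define e where "e y = (if y \<in> g1 then e1 y else e2 y)" for y
  moreover have "e2 y = e y" if "y \<in> g2" for y using that g by (auto simp: e_def)
  ultimately have e: "bij_betw e g1 {0..<s}" "bij_betw e g2 {0..<s}"
    by (metis (no_types, lifting) bij_betw_cong)+
  let ?C = "(lifted_blocks g1 g2 C \<union> cross_blocks e s g1 g2)"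
  have "BBD3 (UNIV \<times> Y) (UNIV \<times> g1) (UNIV \<times> g2) ?C" unfolding BBD3_def
  proof (intro conjI ballI allI impI)
    show "finite ((UNIV :: bool set) \<times> Y)" using g by simp
    show "UNIV \<times> g1 \<union> UNIV \<times> g2 = UNIV \<times> Y" "(UNIV \<times> g1) \<inter> (UNIV \<times> g2) = {}"
      using g by auto
    show "card ((UNIV :: bool set) \<times> g1) = card ((UNIV :: bool set) \<times> g2)" using g by (simp add: card_cartesian_product)
  next
    fix b assume "b \<in> ?C"
    then consider (lift) w b1 where "b = (\<lambda>y. (w y, y)) ` b1" "b1 \<in> C"
      | (cross) a a' c d where "b = {(False, a), (True, a'), (False, c), (True, d)}"
        "a \<in> g1" "a' \<in> g1" "c \<in> g2" "d \<in> g2"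
      unfolding lifted_blocks_def cross_blocks_def by blast
    then have "b \<subseteq> UNIV \<times> Y \<and> card b = 4 \<and> card (b \<inter> UNIV \<times> g1) = 2 \<and> card (b \<inter> UNIV \<times> g2) = 2"
    proof cases
      case lift
      have inj: "inj_on (\<lambda>y. (w y, y)) A" for A by (auto intro: inj_onI)
      have "b \<inter> UNIV \<times> g1 = (\<lambda>y. (w y, y)) ` (b1 \<inter> g1)" "b \<inter> UNIV \<times> g2 = (\<lambda>y. (w y, y)) ` (b1 \<inter> g2)"
        using lift by auto
      then show ?thesis using C[OF lift(2)] lift(1) inj by (auto simp: card_image)
    next
      case cross
      have "a \<notin> g2" "a' \<notin> g2" "c \<notin> g1" "d \<notin> g1" using cross g by auto
      moreover have "a \<noteq> c" "a' \<noteq> d" using cross calculation by auto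
      moreover have "b \<inter> UNIV \<times> g1 = {(False, a), (True, a')}" "b \<inter> UNIV \<times> g2 = {(False, c), (True, d)}"
        using cross calculation by auto
      ultimately show ?thesis using cross g by auto
    qed
    then show "b \<subseteq> UNIV \<times> Y" "card b = 4" "card (b \<inter> UNIV \<times> g1) = 2" "card (b \<inter> UNIV \<times> g2) = 2"
      by auto
  next
    fix T :: "(bool \<times> 'a) set"
    assume T: "T \<subseteq> UNIV \<times> Y \<and> card T = 3 \<and> T \<inter> UNIV \<times> g1 \<noteq> {} \<and> T \<inter> UNIV \<times> g2 \<noteq> {}"
    then have "card T = 3" by blast
    obtain p q r where pqr: "T = {p, q, r}" "p \<noteq> q" "q \<noteq> r" "p \<noteq> r"
      "of_bool (snd p \<in> g2) \<le> (of_bool (snd q \<in> g2) :: nat)" "of_bool (snd q \<in> g2) \<le> (of_bool (snd r \<in> g2) :: nat)"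
      \<comment> \<open>Sorting by membership in \<open>g2\<close> puts the points of
        \<open>g1\<close> first. As the triple meets both groups, only the group of the middle point
        remains open.\<close>
      by (rule card_3_sorted[OF \<open>card T = 3\<close>, of "\<lambda>p. of_bool (snd p \<in> g2) :: nat"])
    have mem: "snd p \<in> g1 \<union> g2" "snd q \<in> g1 \<union> g2" "snd r \<in> g1 \<union> g2" using T pqr(1) g(1) by auto
    have meets: "snd p \<in> g1 \<or> snd q \<in> g1 \<or> snd r \<in> g1" "snd p \<in> g2 \<or> snd q \<in> g2 \<or> snd r \<in> g2"
      using T pqr(1) by auto
    have "snd p \<in> g2 \<Longrightarrow> snd q \<in> g2" "snd q \<in> g2 \<Longrightarrow> snd r \<in> g2"
      using pqr(5,6) by (auto simp: of_bool_def split: if_splits)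
    then have "snd p \<in> g1" "snd r \<in> g2" using meets mem g(2) by blast+
    then consider "snd p \<in> g1" "snd q \<in> g1" "snd r \<in> g2" | "snd p \<in> g1" "snd q \<in> g2" "snd r \<in> g2"
      using mem by blast
    then show "\<exists>!b. b \<in> ?C \<and> T \<subseteq> b"
    proof cases
      case 1
      then show ?thesis
        using doubled_blocks_ex1[OF D e, of "snd p" "snd q" "snd r" "fst p" "fst q" "fst r"] pqr by simp
    next
      case 2
      \<comment> \<open>With two points in \<open>g2\<close>, the preceding lemma applies after
        exchanging the groups; both kinds of blocks are symmetric under this exchange.\<close>
      have "T = {q, r, p}" using pqr by auto
      then show ?thesis using 2
        using doubled_blocks_ex1[OF BBD3_sym[OF D] e(2,1), of "snd q" "snd r" "snd p" "fst q" "fst r" "fst p"] pqr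
        by (simp add: lifted_blocks_sym cross_blocks_sym)
    qed
  qed
  moreover have "embeds Y C (UNIV \<times> Y) ?C" unfolding embeds_def
    by (rule exI[of _ "\<lambda>y. (False, y)"]) (auto intro: inj_onI simp: lifted_blocks_def)
  ultimately show thesis by (rule that)
qed

subsection \<open>Mixed blocks\<close>

definition double_fam :: "int \<Rightarrow> nat \<Rightarrow> nat \<Rightarrow> nat \<Rightarrow> int \<Rightarrow> (nat \<times> int) set set" where
  "double_fam m p q r c = {{(p, x), (p, x'), (q, y), (r, z)} | x x' y z.
     x \<in> {0..<m} \<and> x' \<in> {0..<m} \<and> y \<in> {0..<m} \<and> z \<in> {0..<m} \<and> x \<noteq> x' \<and>
     m dvd x + x' - y - z - c}"

text \<open>The choice \<open>P\<close> of the infinite point reads only \<open>x\<close> and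
  \<open>y\<close>, which suffices because the congruence determines \<open>z\<close>.\<close>

definition inf_fam :: "int \<Rightarrow> nat \<Rightarrow> nat \<Rightarrow> nat \<Rightarrow> int \<Rightarrow> (int \<Rightarrow> int \<Rightarrow> bool) \<Rightarrow> (nat \<times> int) set set" where
  "inf_fam m p q r c P = {{(4, of_bool (P x y)), (p, x), (q, y), (r, z)} | x y z.
     x \<in> {0..<m} \<and> y \<in> {0..<m} \<and> z \<in> {0..<m} \<and> m dvd 2 * x - y - z - c}"

text \<open>The predicates are matched so that, on each pair of layers, the two families containing
  both layers never compete. Writing \<open>a0\<close>, ..., \<open>a3\<close> for the coordinates
  in layers 0 to 3, the congruences turn both predicates on a pair into a test of one difference and
  its negation: \<open>a1 - a0\<close>, \<open>a0 - a2\<close>, \<open>a3 - a1\<close> and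
  \<open>a2 - a3 - 1\<close>. On layers 0, 3 and on layers 1, 2 the parity of the sum of the
  coordinates separates the families instead.\<close>

definition mixed_blocks :: "int \<Rightarrow> (nat \<times> int) set set" where
  "mixed_blocks m =
     double_fam m 0 1 2 0 \<union> double_fam m 1 0 3 0 \<union> double_fam m 2 0 3 1 \<union> double_fam m 3 1 2 (-1) \<union>
     inf_fam m 0 1 2 0 (\<lambda>x y. lower_half m (y - x)) \<union>
     inf_fam m 1 0 3 0 (\<lambda>x y. \<not> lower_half m (x - y)) \<union>
     inf_fam m 2 0 3 1 (\<lambda>x y. \<not> lower_half m (y - x)) \<union>
     inf_fam m 3 1 2 (-1) (\<lambda>x y. lower_half m (x - y))"

lemma double_fam_sym: "double_fam m p q r c = double_fam m p r q c"
proof -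
  have "double_fam m p q r c \<subseteq> double_fam m p r q c" for q r
  proof
    fix b assume "b \<in> double_fam m p q r c"
    then obtain x x' y z where b: "b = {(p, x), (p, x'), (q, y), (r, z)}"
      "x \<in> {0..<m}" "x' \<in> {0..<m}" "y \<in> {0..<m}" "z \<in> {0..<m}" "x \<noteq> x'" "m dvd x + x' - y - z - c"
      unfolding double_fam_def by blast
    have "b = {(p, x), (p, x'), (r, z), (q, y)}" using b(1) by auto
    moreover have "m dvd x + x' - z - y - c" using b(7) by (simp add: algebra_simps)
    ultimately show "b \<in> double_fam m p r q c" using b(2-6) unfolding double_fam_def by blast
  qed
  then show ?thesis by (intro antisym)
qed

lemma dvd_diff_swap: "(m::int) dvd a - b \<longleftrightarrow> m dvd b - a"
  by (metis dvd_minus_iff minus_diff_eq)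

section \<open>Coverage of triples within one family of mixed blocks\<close>

lemma double_fam_ex1_pair:
  assumes m: "0 < m" and d: "p \<noteq> q" "p \<noteq> r" "q \<noteq> r"
    and x: "x \<in> {0..<m}" "x' \<in> {0..<m}" "y \<in> {0..<m}" "x \<noteq> x'"
  shows "\<exists>!b. b \<in> double_fam m p q r c \<and> {(p, x), (p, x'), (q, y)} \<subseteq> b"
proof -
  from residue_ex1[OF m, of "x + x' - y - c"] obtain z where z: "z \<in> {0..<m} \<and> m dvd x + x' - y - c - z"
    "\<forall>w. w \<in> {0..<m} \<and> m dvd x + x' - y - c - w \<longrightarrow> w = z" by (rule ex1E)
  have eq: "x + x' - y - c - w = x + x' - y - w - c" for w by simp
  show ?thesis
  proof (rule ex1I[of _ "{(p, x), (p, x'), (q, y), (r, z)}"])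
    show "{(p, x), (p, x'), (q, y), (r, z)} \<in> double_fam m p q r c \<and> {(p, x), (p, x'), (q, y)} \<subseteq> {(p, x), (p, x'), (q, y), (r, z)}"
      using x z(1) unfolding double_fam_def eq by blast
    fix b assume b: "b \<in> double_fam m p q r c \<and> {(p, x), (p, x'), (q, y)} \<subseteq> b"
    then obtain u u' v w where b1: "b = {(p, u), (p, u'), (q, v), (r, w)}" "w \<in> {0..<m}" "m dvd u + u' - v - w - c"
      unfolding double_fam_def by blast
    have "{(p, x), (p, x'), (q, y)} \<subseteq> b" using b by blast
    then have *: "v = y" "(u = x \<and> u' = x') \<or> (u = x' \<and> u' = x)" using b1(1) d x(4) by auto
    then have "m dvd x + x' - y - c - w" using b1(3) unfolding eq by (auto simp: add.commute)
    then have "w = z" using z(2) b1(2) by blast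
    then show "b = {(p, x), (p, x'), (q, y), (r, z)}" using b1(1) * by auto
  qed
qed

lemma double_fam_ex1_transversal:
  assumes m: "0 < m" and d: "p \<noteq> q" "p \<noteq> r" "q \<noteq> r"
    and x: "x \<in> {0..<m}" "y \<in> {0..<m}" "z \<in> {0..<m}" "\<not> m dvd 2 * x - y - z - c"
  shows "\<exists>!b. b \<in> double_fam m p q r c \<and> {(p, x), (q, y), (r, z)} \<subseteq> b"
proof -
  from residue_ex1[OF m, of "y + z + c - x"] obtain x' where x': "x' \<in> {0..<m} \<and> m dvd y + z + c - x - x'"
    "\<forall>w. w \<in> {0..<m} \<and> m dvd y + z + c - x - w \<longrightarrow> w = x'" by (rule ex1E)
  have eq: "m dvd y + z + c - x - w \<longleftrightarrow> m dvd x + w - y - z - c" for w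
    using dvd_diff_swap[of m "y + z + c" "x + w"] by (simp add: algebra_simps)
  \<comment> \<open>If the forced partner were \<open>x\<close> itself, its congruence would become
    the excluded one for \<open>2 * x\<close>.\<close>
  have "x \<noteq> x'" using x'(1) x(4) unfolding eq by auto
  show ?thesis
  proof (rule ex1I[of _ "{(p, x), (p, x'), (q, y), (r, z)}"])
    show "{(p, x), (p, x'), (q, y), (r, z)} \<in> double_fam m p q r c \<and> {(p, x), (q, y), (r, z)} \<subseteq> {(p, x), (p, x'), (q, y), (r, z)}"
      using x x'(1) \<open>x \<noteq> x'\<close> unfolding double_fam_def eq by blast
    fix b assume b: "b \<in> double_fam m p q r c \<and> {(p, x), (q, y), (r, z)} \<subseteq> b"
    then obtain u u' v w where b1: "b = {(p, u), (p, u'), (q, v), (r, w)}" "u \<in> {0..<m}" "u' \<in> {0..<m}" "m dvd u + u' - v - w - c"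
      unfolding double_fam_def by blast
    have "{(p, x), (q, y), (r, z)} \<subseteq> b" using b by blast
    then have *: "v = y" "w = z" "u = x \<or> u' = x" using b1(1) d by auto
    \<comment> \<open>A block may list its two points of layer \<open>p\<close> in either order;
      \<open>t\<close> is the one that accompanies \<open>x\<close>.\<close>
    define t where "t = (if u = x then u' else u)"
    have t: "t \<in> {0..<m}" "b = {(p, x), (p, t), (q, y), (r, z)}" "m dvd x + t - y - z - c"
      using b1 * by (auto simp: t_def add.commute)
    then have "t = x'" using x'(2) unfolding eq by blast
    then show "b = {(p, x), (p, x'), (q, y), (r, z)}" using t(2) by simp
  qed
qed

lemma inf_fam_ex1_transversal:
  assumes d: "p \<noteq> q" "p \<noteq> r" "q \<noteq> r" "p < 4" "q < 4" "r < 4"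
    and x: "x \<in> {0..<m}" "y \<in> {0..<m}" "z \<in> {0..<m}" "m dvd 2 * x - y - z - c"
  shows "\<exists>!b. b \<in> inf_fam m p q r c P \<and> {(p, x), (q, y), (r, z)} \<subseteq> b"
proof (rule ex1I[of _ "{(4, of_bool (P x y)), (p, x), (q, y), (r, z)}"])
  show "{(4, of_bool (P x y)), (p, x), (q, y), (r, z)} \<in> inf_fam m p q r c P \<and> {(p, x), (q, y), (r, z)} \<subseteq> {(4, of_bool (P x y)), (p, x), (q, y), (r, z)}"
    using x unfolding inf_fam_def by blast
  fix b assume b: "b \<in> inf_fam m p q r c P \<and> {(p, x), (q, y), (r, z)} \<subseteq> b"
  then obtain u v w where "b = {(4, of_bool (P u v)), (p, u), (q, v), (r, w)}"
    unfolding inf_fam_def by blast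
  moreover have "u = x" "v = y" "w = z" using b calculation d by auto
  ultimately show "b = {(4, of_bool (P x y)), (p, x), (q, y), (r, z)}" by simp
qed

text \<open>The partner \<open>x'\<close> with \<open>x + x' = y + z + c\<close> modulo
  \<open>m\<close> always exists. If it differs from \<open>x\<close> it gives a block of the first
  family; if it coincides with \<open>x\<close> the second family supplies the block. These
  alternatives exclude each other.\<close>

lemma transversal_ex1:
  assumes m: "0 < m" and d: "p \<noteq> q" "p \<noteq> r" "q \<noteq> r" "p < 4" "q < 4" "r < 4"
    and x: "x \<in> {0..<m}" "y \<in> {0..<m}" "z \<in> {0..<m}"
  shows "\<exists>!b. b \<in> double_fam m p q r c \<union> inf_fam m p q r c P \<and> {(p, x), (q, y), (r, z)} \<subseteq> b"
proof (cases "m dvd 2 * x - y - z - c")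
  case True
  have "b \<notin> double_fam m p q r c" if T: "{(p, x), (q, y), (r, z)} \<subseteq> b" for b
  proof
    assume "b \<in> double_fam m p q r c"
    then obtain u u' v w where b: "b = {(p, u), (p, u'), (q, v), (r, w)}" "u \<in> {0..<m}" "u' \<in> {0..<m}" "u \<noteq> u'" "m dvd u + u' - v - w - c"
      unfolding double_fam_def by blast
    have *: "v = y" "w = z" "u = x \<or> u' = x" using T b(1) d by auto
    \<comment> \<open>Subtracting the two congruences shows that the two points of the block in
      layer \<open>p\<close> are congruent, hence equal.\<close>
    have "m dvd (2 * x - y - z - c) - (u + u' - v - w - c)" using dvd_diff[OF True b(5)] .
    then have "m dvd u - u' \<or> m dvd u' - u" using * by auto
    then show False using b(2-4) residue_unique by metis
  qed
  then show ?thesis using inf_fam_ex1_transversal[OF d x True] by (metis (no_types, lifting) Un_iff)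
next
  case False
  have "b \<notin> inf_fam m p q r c P" if T: "{(p, x), (q, y), (r, z)} \<subseteq> b" for b
  proof
    assume "b \<in> inf_fam m p q r c P"
    then obtain u v w where b: "b = {(4, of_bool (P u v)), (p, u), (q, v), (r, w)}" "m dvd 2 * u - v - w - c"
      unfolding inf_fam_def by blast
    have "u = x" "v = y" "w = z" using T b(1) d by auto
    then show False using b(2) False by simp
  qed
  then show ?thesis using double_fam_ex1_transversal[OF m d(1-3) x False] by (metis (no_types, lifting) Un_iff)
qed


text \<open>For fixed \<open>x\<close> and \<open>y\<close> the congruence leaves one
  \<open>z\<close>, hence one block, and its infinite point is given by \<open>P x y\<close>. So the
  family covers the triple for exactly one of the two infinite points.\<close>

lemma inf_fam_pq_ex1:
  assumes m: "0 < m" and d: "p \<noteq> q" "p \<noteq> r" "q \<noteq> r" "p < 4" "q < 4" "r < 4"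
    and x: "x \<in> {0..<m}" "y \<in> {0..<m}"
  shows "P x y = h \<Longrightarrow> \<exists>!b. b \<in> inf_fam m p q r c P \<and> {(4, of_bool h), (p, x), (q, y)} \<subseteq> b" (is "_ \<Longrightarrow> ?ex1")
    and "P x y \<noteq> h \<Longrightarrow> b \<in> inf_fam m p q r c P \<Longrightarrow> \<not> {(4, of_bool h), (p, x), (q, y)} \<subseteq> b"
proof -
  have form: "P x y = h \<and> (\<exists>z. b = {(4, of_bool h), (p, x), (q, y), (r, z)} \<and> z \<in> {0..<m} \<and> m dvd 2 * x - y - c - z)"
    if b: "b \<in> inf_fam m p q r c P" "{(4, of_bool h), (p, x), (q, y)} \<subseteq> b" for b
  proof -
    obtain u v w where b1: "b = {(4, of_bool (P u v)), (p, u), (q, v), (r, w)}" "w \<in> {0..<m}" "m dvd 2 * u - v - w - c"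
      using b(1) unfolding inf_fam_def by blast
    have "u = x" "v = y" "P u v = h" using b(2) b1(1) d by auto
    then show ?thesis using b1 by (auto simp: algebra_simps)
  qed
  show "\<not> {(4, of_bool h), (p, x), (q, y)} \<subseteq> b" if "P x y \<noteq> h" "b \<in> inf_fam m p q r c P"
    using form that by blast
  assume P: "P x y = h"
  from residue_ex1[OF m, of "2 * x - y - c"] obtain z where z: "z \<in> {0..<m} \<and> m dvd 2 * x - y - c - z"
    "\<forall>w. w \<in> {0..<m} \<and> m dvd 2 * x - y - c - w \<longrightarrow> w = z" by (rule ex1E)
  have eq: "2 * x - y - c - z = 2 * x - y - z - c" by simp
  show ?ex1
  proof (rule ex1I[of _ "{(4, of_bool h), (p, x), (q, y), (r, z)}"])
    show "{(4, of_bool h), (p, x), (q, y), (r, z)} \<in> inf_fam m p q r c P \<and>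
        {(4, of_bool h), (p, x), (q, y)} \<subseteq> {(4, of_bool h), (p, x), (q, y), (r, z)}"
      using x z(1) P unfolding inf_fam_def eq by blast
    fix b assume "b \<in> inf_fam m p q r c P \<and> {(4, of_bool h), (p, x), (q, y)} \<subseteq> b"
    then obtain w where w: "b = {(4, of_bool h), (p, x), (q, y), (r, w)}" "w \<in> {0..<m} \<and> m dvd 2 * x - y - c - w"
      using form[of b] by blast
    then show "b = {(4, of_bool h), (p, x), (q, y), (r, z)}" using z(2) by simp
  qed
qed

text \<open>Now \<open>y\<close> is the forced coordinate, although \<open>P\<close> reads it. The
  hypothesis on \<open>P\<close> supplies its value \<open>Q\<close> at that forced
  \<open>y\<close>, so that coverage becomes a condition on the given pair \<open>x\<close>,
  \<open>z\<close>.\<close>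

lemma inf_fam_pr_ex1:
  assumes m: "0 < m" and d: "p \<noteq> q" "p \<noteq> r" "q \<noteq> r" "p < 4" "q < 4" "r < 4"
    and x: "x \<in> {0..<m}" "z \<in> {0..<m}"
    and P: "\<And>y. m dvd 2 * x - z - c - y \<Longrightarrow> P x y = Q"
  shows "Q = h \<Longrightarrow> \<exists>!b. b \<in> inf_fam m p q r c P \<and> {(4, of_bool h), (p, x), (r, z)} \<subseteq> b" (is "_ \<Longrightarrow> ?ex1")
    and "Q \<noteq> h \<Longrightarrow> b \<in> inf_fam m p q r c P \<Longrightarrow> \<not> {(4, of_bool h), (p, x), (r, z)} \<subseteq> b"
proof -
  have eq: "2 * x - z - c - y = 2 * x - y - z - c" for y by simp
  have form: "Q = h \<and> (\<exists>y. b = {(4, of_bool h), (p, x), (q, y), (r, z)} \<and> y \<in> {0..<m} \<and> m dvd 2 * x - z - c - y)"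
    if b: "b \<in> inf_fam m p q r c P" "{(4, of_bool h), (p, x), (r, z)} \<subseteq> b" for b
  proof -
    obtain u v w where b1: "b = {(4, of_bool (P u v)), (p, u), (q, v), (r, w)}" "v \<in> {0..<m}" "m dvd 2 * u - v - w - c"
      using b(1) unfolding inf_fam_def by blast
    have *: "u = x" "w = z" "P u v = h" using b(2) b1(1) d by auto
    moreover have "P x v = Q" using P[unfolded eq] b1(3) * by simp
    ultimately show ?thesis using b1 by (auto simp: algebra_simps)
  qed
  show "\<not> {(4, of_bool h), (p, x), (r, z)} \<subseteq> b" if "Q \<noteq> h" "b \<in> inf_fam m p q r c P"
    using form that by blast
  assume Q: "Q = h"
  from residue_ex1[OF m, of "2 * x - z - c"] obtain y where y: "y \<in> {0..<m} \<and> m dvd 2 * x - z - c - y"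
    "\<forall>w. w \<in> {0..<m} \<and> m dvd 2 * x - z - c - w \<longrightarrow> w = y" by (rule ex1E)
  have Pxy: "P x y = h" using P y(1) Q by blast
  show ?ex1
  proof (rule ex1I[of _ "{(4, of_bool h), (p, x), (q, y), (r, z)}"])
    show "{(4, of_bool h), (p, x), (q, y), (r, z)} \<in> inf_fam m p q r c P \<and>
        {(4, of_bool h), (p, x), (r, z)} \<subseteq> {(4, of_bool h), (p, x), (q, y), (r, z)}"
      using x y(1) Pxy unfolding inf_fam_def eq by blast
    fix b assume "b \<in> inf_fam m p q r c P \<and> {(4, of_bool h), (p, x), (r, z)} \<subseteq> b"
    then obtain w where w: "b = {(4, of_bool h), (p, x), (q, w), (r, z)}" "w \<in> {0..<m} \<and> m dvd 2 * x - z - c - w"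
      using form[of b] by blast
    then show "b = {(4, of_bool h), (p, x), (q, y), (r, z)}" using y(2) by simp
  qed
qed

text \<open>Here \<open>x\<close> has to be a half of \<open>y + z + c\<close>. For an even sum
  there are two halves, and \<open>flip\<close> sends them to different infinite points, so each
  infinite point gets one block. For an odd sum there is no half, since \<open>m\<close> is
  even.\<close>

lemma inf_fam_qr_ex1:
  assumes m: "even m" "0 < m" and d: "p \<noteq> q" "p \<noteq> r" "q \<noteq> r" "p < 4" "q < 4" "r < 4"
    and x: "y \<in> {0..<m}" "z \<in> {0..<m}"
    and flip: "\<And>x x'. m dvd x' - (x + m div 2) \<Longrightarrow> P x' y \<longleftrightarrow> \<not> P x y"
  shows "even (y + z + c) \<Longrightarrow> \<exists>!b. b \<in> inf_fam m p q r c P \<and> {(4, of_bool h), (q, y), (r, z)} \<subseteq> b" (is "_ \<Longrightarrow> ?ex1")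
    and "odd (y + z + c) \<Longrightarrow> b \<in> inf_fam m p q r c P \<Longrightarrow> \<not> {(4, of_bool h), (q, y), (r, z)} \<subseteq> b"
proof -
  have eq: "2 * x - (y + z + c) = 2 * x - y - z - c" for x by simp
  have form: "\<exists>x. b = {(4, of_bool h), (p, x), (q, y), (r, z)} \<and> x \<in> {0..<m} \<and> m dvd 2 * x - (y + z + c) \<and> P x y = h"
    if b: "b \<in> inf_fam m p q r c P" "{(4, of_bool h), (q, y), (r, z)} \<subseteq> b" for b
  proof -
    obtain u v w where b1: "b = {(4, of_bool (P u v)), (p, u), (q, v), (r, w)}" "u \<in> {0..<m}" "m dvd 2 * u - v - w - c"
      using b(1) unfolding inf_fam_def by blast
    have *: "v = y" "w = z" "P u v = h" using b(2) b1(1) d by auto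
    then show ?thesis using b1 unfolding eq by auto
  qed
  show "\<not> {(4, of_bool h), (q, y), (r, z)} \<subseteq> b" if odd: "odd (y + z + c)" and b: "b \<in> inf_fam m p q r c P"
  proof
    assume "{(4, of_bool h), (q, y), (r, z)} \<subseteq> b"
    then obtain x where "m dvd 2 * x - (y + z + c)" using form[OF b] by blast
    then have "even (2 * x - (y + z + c))" using m(1) by (rule dvd_trans[rotated])
    then show False using odd by simp
  qed
  assume even: "even (y + z + c)"
  from halving_ex1[of m _ "\<lambda>x. P x y" h, OF m even flip]
  obtain x where x': "x \<in> {0..<m} \<and> m dvd 2 * x - (y + z + c) \<and> P x y = h"
    "\<forall>w. w \<in> {0..<m} \<and> m dvd 2 * w - (y + z + c) \<and> P w y = h \<longrightarrow> w = x" by (rule ex1E)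
  show ?ex1
  proof (rule ex1I[of _ "{(4, of_bool h), (p, x), (q, y), (r, z)}"])
    show "{(4, of_bool h), (p, x), (q, y), (r, z)} \<in> inf_fam m p q r c P \<and>
        {(4, of_bool h), (q, y), (r, z)} \<subseteq> {(4, of_bool h), (p, x), (q, y), (r, z)}"
      using x x'(1) unfolding inf_fam_def eq by blast
    fix b assume "b \<in> inf_fam m p q r c P \<and> {(4, of_bool h), (q, y), (r, z)} \<subseteq> b"
    then obtain w where w: "b = {(4, of_bool h), (p, w), (q, y), (r, z)}" "w \<in> {0..<m} \<and> m dvd 2 * w - (y + z + c) \<and> P w y = h"
      using form[of b] by blast
    then show "b = {(4, of_bool h), (p, x), (q, y), (r, z)}" using x'(2) by simp
  qed
qed

section \<open>Combining the families: pairs in a layer, transversals, and triples with one infinite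
  point\<close>

lemma double_fam_fst: "b \<in> double_fam m p q r c \<Longrightarrow> a \<in> b \<Longrightarrow> fst a \<in> {p, q, r}"
  unfolding double_fam_def by auto

lemma inf_fam_fst: "b \<in> inf_fam m p q r c P \<Longrightarrow> a \<in> b \<Longrightarrow> fst a \<in> {4, p, q, r}"
  unfolding inf_fam_def by auto

lemma double_fam_single:
  "\<lbrakk>b \<in> double_fam m p q r c; (i, x) \<in> b; (i, x') \<in> b; i \<noteq> p; q \<noteq> r\<rbrakk> \<Longrightarrow> x = x'"
  unfolding double_fam_def by auto

lemma inf_fam_single:
  "\<lbrakk>b \<in> inf_fam m p q r c P; (i, x) \<in> b; (i, x') \<in> b; p \<noteq> q; p \<noteq> r; q \<noteq> r; p \<noteq> 4; q \<noteq> 4; r \<noteq> 4\<rbrakk> \<Longrightarrow> x = x'"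
  unfolding inf_fam_def by auto

text \<open>Reduces coverage in a large set of blocks to the few families that can contain the given
  triple.\<close>

lemma ex1_block_mono:
  assumes "\<exists>!b. b \<in> A \<and> T \<subseteq> b" "A \<subseteq> B" "\<And>b. b \<in> B \<Longrightarrow> T \<subseteq> b \<Longrightarrow> b \<in> A"
  shows "\<exists>!b. b \<in> B \<and> T \<subseteq> b"
  using assms by (metis subsetD)

lemma lower_half_flip:
  assumes "even m" "0 < m" "m dvd x' - (x + m div 2)"
  shows "lower_half m (x' - a) \<longleftrightarrow> \<not> lower_half m (x - a)"
    and "lower_half m (a - x') \<longleftrightarrow> \<not> lower_half m (a - x)"
proof -
  have "m dvd (x' - a) - ((x - a) + m div 2)" using assms(3) by (simp add: algebra_simps)
  then show "lower_half m (x' - a) \<longleftrightarrow> \<not> lower_half m (x - a)"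
    using lower_half_shift[OF assms(1,2)] lower_half_cong by blast
  \<comment> \<open>Reading the shift backwards avoids a sign change: \<open>a - x\<close> is the
    shift of \<open>a - x'\<close> by \<open>+ m div 2\<close>.\<close>
  have "(a - x) - ((a - x') + m div 2) = x' - (x + m div 2)" by simp
  then have "m dvd (a - x) - ((a - x') + m div 2)" using assms(3) by metis
  then show "lower_half m (a - x') \<longleftrightarrow> \<not> lower_half m (a - x)"
    using lower_half_shift[OF assms(1,2)] lower_half_cong by blast
qed

lemma mixed_blocksE:
  assumes "b \<in> mixed_blocks m"
  obtains (D0) "b \<in> double_fam m 0 1 2 0" | (D1) "b \<in> double_fam m 1 0 3 0"
    | (D2) "b \<in> double_fam m 2 0 3 1" | (D3) "b \<in> double_fam m 3 1 2 (-1)"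
    | (I0) "b \<in> inf_fam m 0 1 2 0 (\<lambda>x y. lower_half m (y - x))"
    | (I1) "b \<in> inf_fam m 1 0 3 0 (\<lambda>x y. \<not> lower_half m (x - y))"
    | (I2) "b \<in> inf_fam m 2 0 3 1 (\<lambda>x y. \<not> lower_half m (y - x))"
    | (I3) "b \<in> inf_fam m 3 1 2 (-1) (\<lambda>x y. lower_half m (x - y))"
  using assms unfolding mixed_blocks_def by blast

text \<open>Two points in one layer can lie together only in a block of the doubling family of that
  layer. The listed pairs are all ordered pairs of distinct layers except those within 0, 3 and
  within 1, 2, which belong to the balanced designs.\<close>

lemma mixed_pair_ex1:
  assumes m: "0 < m" and x: "x \<in> {0..<m}" "x' \<in> {0..<m}" "y \<in> {0..<m}" "x \<noteq> x'"
    and pq: "(p, q) \<in> {(0,1), (0,2), (1,0), (1,3), (2,0), (2,3), (3,1), (3,2)}"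
  shows "\<exists>!b. b \<in> mixed_blocks m \<and> {(p, x), (p, x'), (q, y)} \<subseteq> b"
proof -
  let ?T = "{(p, x), (p, x'), (q, y)}"
  have only: "p' = p" if "b \<in> double_fam m p' q' r' c" "?T \<subseteq> b" "q' \<noteq> r'" for b p' q' r' c
    using double_fam_single[OF that(1), of p x x'] that x by auto
  have none: "\<not> ?T \<subseteq> b" if "b \<in> inf_fam m p' q' r' c P" "distinct [p', q', r', 4]" for b p' q' r' c P
    using inf_fam_single[of b m p' q' r' c P p x x'] that x by auto
  have cases: "b \<in> double_fam m 0 1 2 0 \<and> p = 0 \<or> b \<in> double_fam m 1 0 3 0 \<and> p = 1 \<or>
     b \<in> double_fam m 2 0 3 1 \<and> p = 2 \<or> b \<in> double_fam m 3 1 2 (-1) \<and> p = 3"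
    if "b \<in> mixed_blocks m" "?T \<subseteq> b" for b
    using that(1)
  proof (cases rule: mixed_blocksE)
    case D0 then show ?thesis using only[OF D0 that(2)] by simp
  next
    case D1 then show ?thesis using only[OF D1 that(2)] by simp
  next
    case D2 then show ?thesis using only[OF D2 that(2)] by simp
  next
    case D3 then show ?thesis using only[OF D3 that(2)] by simp
  next
    case I0 then show ?thesis using none[OF I0] that(2) by simp
  next
    case I1 then show ?thesis using none[OF I1] that(2) by simp
  next
    case I2 then show ?thesis using none[OF I2] that(2) by simp
  next
    case I3 then show ?thesis using none[OF I3] that(2) by simp
  qed
  have sub: "double_fam m 0 1 2 0 \<subseteq> mixed_blocks m" "double_fam m 1 0 3 0 \<subseteq> mixed_blocks m"
    "double_fam m 2 0 3 1 \<subseteq> mixed_blocks m" "double_fam m 3 1 2 (-1) \<subseteq> mixed_blocks m"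
    unfolding mixed_blocks_def by blast+
  have lift: ?thesis if "A = double_fam m p q r c" "A \<subseteq> mixed_blocks m" "p \<noteq> q \<and> p \<noteq> r \<and> q \<noteq> r"
    "\<And>b. b \<in> mixed_blocks m \<Longrightarrow> ?T \<subseteq> b \<Longrightarrow> b \<in> A" for r c A
  proof (rule ex1_block_mono)
    show "\<exists>!b. b \<in> A \<and> ?T \<subseteq> b"
      unfolding that(1) using that(3) by (intro double_fam_ex1_pair[OF m _ _ _ x]) auto
  qed (use that in auto)
  from pq consider "p = 0" "q = 1" | "p = 0" "q = 2" | "p = 1" "q = 0" | "p = 1" "q = 3"
    | "p = 2" "q = 0" | "p = 2" "q = 3" | "p = 3" "q = 1" | "p = 3" "q = 2" by auto
  then show ?thesis
  proof cases
    case 1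
    have "double_fam m 0 1 2 0 = double_fam m p q 2 0" using 1 double_fam_sym[of m 0 1 2 0] by simp
    then show ?thesis by (rule lift[OF _ sub(1)]) (use 1 cases in auto)
  next
    case 2
    \<comment> \<open>The last two layers of a family are interchangeable, so \<open>q\<close> may
      be moved into the first of these positions.\<close>
    have "double_fam m 0 1 2 0 = double_fam m p q 1 0" using 2 double_fam_sym[of m 0 2 1 0] by simp
    then show ?thesis by (rule lift[OF _ sub(1)]) (use 2 cases in auto)
  next
    case 3
    have "double_fam m 1 0 3 0 = double_fam m p q 3 0" using 3 double_fam_sym[of m 1 0 3 0] by simp
    then show ?thesis by (rule lift[OF _ sub(2)]) (use 3 cases in auto)
  next
    case 4
    have "double_fam m 1 0 3 0 = double_fam m p q 0 0" using 4 double_fam_sym[of m 1 3 0 0] by simp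
    then show ?thesis by (rule lift[OF _ sub(2)]) (use 4 cases in auto)
  next
    case 5
    have "double_fam m 2 0 3 1 = double_fam m p q 3 1" using 5 double_fam_sym[of m 2 0 3 1] by simp
    then show ?thesis by (rule lift[OF _ sub(3)]) (use 5 cases in auto)
  next
    case 6
    have "double_fam m 2 0 3 1 = double_fam m p q 0 1" using 6 double_fam_sym[of m 2 3 0 1] by simp
    then show ?thesis by (rule lift[OF _ sub(3)]) (use 6 cases in auto)
  next
    case 7
    have "double_fam m 3 1 2 (-1) = double_fam m p q 2 (-1)" using 7 double_fam_sym[of m 3 1 2 "-1"] by simp
    then show ?thesis by (rule lift[OF _ sub(4)]) (use 7 cases in auto)
  next
    case 8
    have "double_fam m 3 1 2 (-1) = double_fam m p q 1 (-1)" using 8 double_fam_sym[of m 3 2 1 "-1"] by simp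
    then show ?thesis by (rule lift[OF _ sub(4)]) (use 8 cases in auto)
  qed
qed

text \<open>Each three of the four layers occur together in just one quadruple
  \<open>(p; q, r; c)\<close>. Hence only the two families with these parameters can contain the
  triple, and \<open>transversal_ex1\<close> decides between them.\<close>

lemma mixed_transversal_ex1:
  assumes m: "0 < m" and x: "x \<in> {0..<m}" "y \<in> {0..<m}" "z \<in> {0..<m}"
    and pqr: "(p, q, r) \<in> {(0,1,2), (1,0,3), (2,0,3), (3,1,2)}"
  shows "\<exists>!b. b \<in> mixed_blocks m \<and> {(p, x), (q, y), (r, z)} \<subseteq> b"
proof -
  let ?P0 = "\<lambda>x y. lower_half m (y - x)" and ?P1 = "\<lambda>x y. \<not> lower_half m (x - y)"
    and ?P2 = "\<lambda>x y. \<not> lower_half m (y - x)" and ?P3 = "\<lambda>x y. lower_half m (x - y)"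
  let ?F0 = "double_fam m 0 1 2 0 \<union> inf_fam m 0 1 2 0 ?P0" and ?F1 = "double_fam m 1 0 3 0 \<union> inf_fam m 1 0 3 0 ?P1"
    and ?F2 = "double_fam m 2 0 3 1 \<union> inf_fam m 2 0 3 1 ?P2" and ?F3 = "double_fam m 3 1 2 (-1) \<union> inf_fam m 3 1 2 (-1) ?P3"
  let ?T = "{(p, x), (q, y), (r, z)}"
  have no4: "p \<noteq> 4" "q \<noteq> 4" "r \<noteq> 4" using pqr by auto
  have D: "{p, q, r} \<subseteq> {p', q', r'}" if "b \<in> double_fam m p' q' r' c" "?T \<subseteq> b" for b p' q' r' c
    using that double_fam_fst[OF that(1), of "(p, x)"] double_fam_fst[OF that(1), of "(q, y)"]
      double_fam_fst[OF that(1), of "(r, z)"] by auto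
  have I: "{p, q, r} \<subseteq> {p', q', r'}" if "b \<in> inf_fam m p' q' r' c P" "?T \<subseteq> b" for b p' q' r' c P
    using that inf_fam_fst[OF that(1), of "(p, x)"] inf_fam_fst[OF that(1), of "(q, y)"]
      inf_fam_fst[OF that(1), of "(r, z)"] no4 by auto
  have cases: "b \<in> ?F0 \<and> {p, q, r} \<subseteq> {0, 1, 2} \<or> b \<in> ?F1 \<and> {p, q, r} \<subseteq> {1, 0, 3} \<or>
      b \<in> ?F2 \<and> {p, q, r} \<subseteq> {2, 0, 3} \<or> b \<in> ?F3 \<and> {p, q, r} \<subseteq> {3, 1, 2}"
    if "b \<in> mixed_blocks m" "?T \<subseteq> b" for b
    using that(1)
  proof (cases rule: mixed_blocksE)
    case D0 then show ?thesis using D[OF D0 that(2)] by blast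
  next
    case D1 then show ?thesis using D[OF D1 that(2)] by blast
  next
    case D2 then show ?thesis using D[OF D2 that(2)] by blast
  next
    case D3 then show ?thesis using D[OF D3 that(2)] by blast
  next
    case I0 then show ?thesis using I[OF I0 that(2)] by blast
  next
    case I1 then show ?thesis using I[OF I1 that(2)] by blast
  next
    case I2 then show ?thesis using I[OF I2 that(2)] by blast
  next
    case I3 then show ?thesis using I[OF I3 that(2)] by blast
  qed
  have sub: "?F0 \<subseteq> mixed_blocks m" "?F1 \<subseteq> mixed_blocks m" "?F2 \<subseteq> mixed_blocks m" "?F3 \<subseteq> mixed_blocks m"
    unfolding mixed_blocks_def by blast+
  from pqr consider "p = 0" "q = 1" "r = 2" | "p = 1" "q = 0" "r = 3" | "p = 2" "q = 0" "r = 3" | "p = 3" "q = 1" "r = 2"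
    by auto
  then show ?thesis
  proof cases
    case 1
    have "\<exists>!b. b \<in> ?F0 \<and> ?T \<subseteq> b" unfolding 1 by (rule transversal_ex1[OF m _ _ _ _ _ _ x]) simp_all
    then show ?thesis by (rule ex1_block_mono[OF _ sub(1)]) (use cases 1 in auto)
  next
    case 2
    have "\<exists>!b. b \<in> ?F1 \<and> ?T \<subseteq> b" unfolding 2 by (rule transversal_ex1[OF m _ _ _ _ _ _ x]) simp_all
    then show ?thesis by (rule ex1_block_mono[OF _ sub(2)]) (use cases 2 in auto)
  next
    case 3
    have "\<exists>!b. b \<in> ?F2 \<and> ?T \<subseteq> b" unfolding 3 by (rule transversal_ex1[OF m _ _ _ _ _ _ x]) simp_all
    then show ?thesis by (rule ex1_block_mono[OF _ sub(3)]) (use cases 3 in auto)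
  next
    case 4
    have "\<exists>!b. b \<in> ?F3 \<and> ?T \<subseteq> b" unfolding 4 by (rule transversal_ex1[OF m _ _ _ _ _ _ x]) simp_all
    then show ?thesis by (rule ex1_block_mono[OF _ sub(4)]) (use cases 4 in auto)
  qed
qed

text \<open>The pattern for two layers and an infinite point: two families are candidates, and a
  condition \<open>Q\<close> on the triple tells which of them covers it.\<close>

lemma ex1_block_choice:
  assumes "Q \<Longrightarrow> \<exists>!b. b \<in> A \<and> T \<subseteq> b" "\<And>b. \<not> Q \<Longrightarrow> b \<in> A \<Longrightarrow> \<not> T \<subseteq> b"
    and "\<not> Q \<Longrightarrow> \<exists>!b. b \<in> B \<and> T \<subseteq> b" "\<And>b. Q \<Longrightarrow> b \<in> B \<Longrightarrow> \<not> T \<subseteq> b"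
  shows "\<exists>!b. b \<in> A \<union> B \<and> T \<subseteq> b"
proof (cases Q)
  case True
  show ?thesis by (rule ex1_block_mono[OF assms(1)[OF True]]) (use assms(4)[OF True] in auto)
next
  case False
  show ?thesis by (rule ex1_block_mono[OF assms(3)[OF False]]) (use assms(2)[OF False] in auto)
qed

text \<open>Every pair of layers is contained in exactly two of the four families with infinite
  points. The six cases verify that their conditions are complementary, by opposite half tests or by
  opposite parities.\<close>

lemma mixed_inf_ex1:
  assumes m: "even m" "0 < m" and x: "x \<in> {0..<m}" "y \<in> {0..<m}"
    and ij: "(i, j) \<in> {(0,1), (0,2), (0,3), (1,2), (1,3), (2,3)}"
  shows "\<exists>!b. b \<in> mixed_blocks m \<and> {(4, of_bool h), (i, x), (j, y)} \<subseteq> b"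
proof -
  let ?P0 = "\<lambda>x y. lower_half m (y - x)" and ?P1 = "\<lambda>x y. \<not> lower_half m (x - y)"
    and ?P2 = "\<lambda>x y. \<not> lower_half m (y - x)" and ?P3 = "\<lambda>x y. lower_half m (x - y)"
  let ?F0 = "inf_fam m 0 1 2 0 ?P0" and ?F1 = "inf_fam m 1 0 3 0 ?P1"
    and ?F2 = "inf_fam m 2 0 3 1 ?P2" and ?F3 = "inf_fam m 3 1 2 (-1) ?P3"
  let ?T = "{(4, of_bool h), (i, x), (j, y)}"
  have no4: "i \<noteq> 4" "j \<noteq> 4" using ij by auto
  have D: "4 \<in> {p', q', r'}" if "b \<in> double_fam m p' q' r' c" "?T \<subseteq> b" for b p' q' r' c
    using that double_fam_fst[OF that(1), of "(4, of_bool h)"] by auto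
  have I: "{i, j} \<subseteq> {p', q', r'}" if "b \<in> inf_fam m p' q' r' c P" "?T \<subseteq> b" for b p' q' r' c P
    using that inf_fam_fst[OF that(1), of "(i, x)"] inf_fam_fst[OF that(1), of "(j, y)"] no4 by auto
  have cases: "b \<in> ?F0 \<and> {i, j} \<subseteq> {0, 1, 2} \<or> b \<in> ?F1 \<and> {i, j} \<subseteq> {1, 0, 3} \<or>
      b \<in> ?F2 \<and> {i, j} \<subseteq> {2, 0, 3} \<or> b \<in> ?F3 \<and> {i, j} \<subseteq> {3, 1, 2}"
    if "b \<in> mixed_blocks m" "?T \<subseteq> b" for b
    using that(1)
  proof (cases rule: mixed_blocksE)
    case D0 then show ?thesis using D[OF D0 that(2)] by simp
  next
    case D1 then show ?thesis using D[OF D1 that(2)] by simp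
  next
    case D2 then show ?thesis using D[OF D2 that(2)] by simp
  next
    case D3 then show ?thesis using D[OF D3 that(2)] by simp
  next
    case I0 then show ?thesis using I[OF I0 that(2)] by blast
  next
    case I1 then show ?thesis using I[OF I1 that(2)] by blast
  next
    case I2 then show ?thesis using I[OF I2 that(2)] by blast
  next
    case I3 then show ?thesis using I[OF I3 that(2)] by blast
  qed
  have sub: "?F0 \<subseteq> mixed_blocks m" "?F1 \<subseteq> mixed_blocks m" "?F2 \<subseteq> mixed_blocks m" "?F3 \<subseteq> mixed_blocks m"
    unfolding mixed_blocks_def by blast+
  note flip = lower_half_flip[OF m]
  \<comment> \<open>Needed when the larger layer \<open>j\<close> is the distinguished layer
    \<open>p\<close> of the family.\<close>
  have swap: "?T = {(4, of_bool h), (j, y), (i, x)}" by auto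
  from ij consider "i = 0" "j = 1" | "i = 0" "j = 2" | "i = 0" "j = 3" | "i = 1" "j = 2" | "i = 1" "j = 3" | "i = 2" "j = 3"
    by auto
  then show ?thesis
  proof cases
    case 1
    have "\<exists>!b. b \<in> ?F0 \<union> ?F1 \<and> ?T \<subseteq> b"
    proof (rule ex1_block_choice[where Q = "lower_half m (y - x) = h"])
      show "\<exists>!b. b \<in> ?F0 \<and> ?T \<subseteq> b" if " (lower_half m (y - x) = h)"
        unfolding 1 by (rule inf_fam_pq_ex1(1)[OF m(2) _ _ _ _ _ _ x]) (use that flip in auto)
      show "\<not> ?T \<subseteq> b" if "\<not> (lower_half m (y - x) = h)" "b \<in> ?F0" for b
        unfolding 1 by (rule inf_fam_pq_ex1(2)[OF m(2) _ _ _ _ _ _ x]) (use that flip in auto)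
      show "\<exists>!b. b \<in> ?F1 \<and> ?T \<subseteq> b" if "\<not> (lower_half m (y - x) = h)"
        unfolding swap unfolding 1 by (rule inf_fam_pq_ex1(1)[OF m(2) _ _ _ _ _ _ x(2,1)]) (use that flip in auto)
      show "\<not> ?T \<subseteq> b" if " (lower_half m (y - x) = h)" "b \<in> ?F1" for b
        unfolding swap unfolding 1 by (rule inf_fam_pq_ex1(2)[OF m(2) _ _ _ _ _ _ x(2,1)]) (use that flip in auto)
    qed
    then show ?thesis by (rule ex1_block_mono) (use sub cases 1 in auto)
  next
    case 2
    \<comment> \<open>Eliminates the coordinate \<open>w\<close> in layer 1: from
      \<open>2 * x = y + w\<close> modulo \<open>m\<close> follows
      \<open>w - x = x - y\<close>.\<close>
    have P0: "?P0 x w = lower_half m (x - y)" if "m dvd 2 * x - y - 0 - w" for w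
    proof -
      have "m dvd (w - x) - (x - y)" using that dvd_diff_swap[of m "2 * x - y" w] by (simp add: algebra_simps)
      then show ?thesis by (rule lower_half_cong)
    qed
    have "\<exists>!b. b \<in> ?F0 \<union> ?F2 \<and> ?T \<subseteq> b"
    proof (rule ex1_block_choice[where Q = "lower_half m (x - y) = h"])
      show "\<exists>!b. b \<in> ?F0 \<and> ?T \<subseteq> b" if " (lower_half m (x - y) = h)"
        unfolding 2 by (rule inf_fam_pr_ex1(1)[where P = ?P0, OF m(2) _ _ _ _ _ _ x P0]) (use that flip in auto)
      show "\<not> ?T \<subseteq> b" if "\<not> (lower_half m (x - y) = h)" "b \<in> ?F0" for b
        unfolding 2 by (rule inf_fam_pr_ex1(2)[where P = ?P0, OF m(2) _ _ _ _ _ _ x P0]) (use that flip in auto)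
      show "\<exists>!b. b \<in> ?F2 \<and> ?T \<subseteq> b" if "\<not> (lower_half m (x - y) = h)"
        unfolding swap unfolding 2 by (rule inf_fam_pq_ex1(1)[OF m(2) _ _ _ _ _ _ x(2,1)]) (use that flip in auto)
      show "\<not> ?T \<subseteq> b" if " (lower_half m (x - y) = h)" "b \<in> ?F2" for b
        unfolding swap unfolding 2 by (rule inf_fam_pq_ex1(2)[OF m(2) _ _ _ _ _ _ x(2,1)]) (use that flip in auto)
    qed
    then show ?thesis by (rule ex1_block_mono) (use sub cases 2 in auto)
  next
    case 3
    have "\<exists>!b. b \<in> ?F1 \<union> ?F2 \<and> ?T \<subseteq> b"
    \<comment> \<open>Neither layer 0 nor layer 3 is distinguished in these two families. Their
      constants are 0 and 1, so exactly one of the two sums to be halved is even.\<close>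
    proof (rule ex1_block_choice[where Q = "even (x + y)"])
      show "\<exists>!b. b \<in> ?F1 \<and> ?T \<subseteq> b" if " (even (x + y))"
        unfolding 3 by (rule inf_fam_qr_ex1(1)[OF m _ _ _ _ _ _ x]) (use that flip in auto)
      show "\<not> ?T \<subseteq> b" if "\<not> (even (x + y))" "b \<in> ?F1" for b
        unfolding 3 by (rule inf_fam_qr_ex1(2)[OF m _ _ _ _ _ _ x]) (use that flip in auto)
      show "\<exists>!b. b \<in> ?F2 \<and> ?T \<subseteq> b" if "\<not> (even (x + y))"
        unfolding 3 by (rule inf_fam_qr_ex1(1)[OF m _ _ _ _ _ _ x]) (use that flip in auto)
      show "\<not> ?T \<subseteq> b" if " (even (x + y))" "b \<in> ?F2" for b
        unfolding 3 by (rule inf_fam_qr_ex1(2)[OF m _ _ _ _ _ _ x]) (use that flip in auto)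
    qed
    then show ?thesis by (rule ex1_block_mono) (use sub cases 3 in auto)
  next
    case 4
    have "\<exists>!b. b \<in> ?F0 \<union> ?F3 \<and> ?T \<subseteq> b"
    proof (rule ex1_block_choice[where Q = "even (x + y)"])
      show "\<exists>!b. b \<in> ?F0 \<and> ?T \<subseteq> b" if " (even (x + y))"
        unfolding 4 by (rule inf_fam_qr_ex1(1)[OF m _ _ _ _ _ _ x]) (use that flip in auto)
      show "\<not> ?T \<subseteq> b" if "\<not> (even (x + y))" "b \<in> ?F0" for b
        unfolding 4 by (rule inf_fam_qr_ex1(2)[OF m _ _ _ _ _ _ x]) (use that flip in auto)
      show "\<exists>!b. b \<in> ?F3 \<and> ?T \<subseteq> b" if "\<not> (even (x + y))"
        unfolding 4 by (rule inf_fam_qr_ex1(1)[OF m _ _ _ _ _ _ x]) (use that flip in auto)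
      show "\<not> ?T \<subseteq> b" if " (even (x + y))" "b \<in> ?F3" for b
        unfolding 4 by (rule inf_fam_qr_ex1(2)[OF m _ _ _ _ _ _ x]) (use that flip in auto)
    qed
    then show ?thesis by (rule ex1_block_mono) (use sub cases 4 in auto)
  next
    case 5
    have P1: "?P1 x w = (\<not> lower_half m (y - x))" if "m dvd 2 * x - y - 0 - w" for w
    proof -
      have "m dvd (x - w) - (y - x)" using that by (simp add: algebra_simps)
      then show ?thesis using lower_half_cong by blast
    qed
    have "\<exists>!b. b \<in> ?F1 \<union> ?F3 \<and> ?T \<subseteq> b"
    proof (rule ex1_block_choice[where Q = "lower_half m (y - x) \<noteq> h"])
      show "\<exists>!b. b \<in> ?F1 \<and> ?T \<subseteq> b" if " (lower_half m (y - x) \<noteq> h)"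
        unfolding 5 by (rule inf_fam_pr_ex1(1)[where P = ?P1, OF m(2) _ _ _ _ _ _ x P1]) (use that flip in auto)
      show "\<not> ?T \<subseteq> b" if "\<not> (lower_half m (y - x) \<noteq> h)" "b \<in> ?F1" for b
        unfolding 5 by (rule inf_fam_pr_ex1(2)[where P = ?P1, OF m(2) _ _ _ _ _ _ x P1]) (use that flip in auto)
      show "\<exists>!b. b \<in> ?F3 \<and> ?T \<subseteq> b" if "\<not> (lower_half m (y - x) \<noteq> h)"
        unfolding swap unfolding 5 by (rule inf_fam_pq_ex1(1)[OF m(2) _ _ _ _ _ _ x(2,1)]) (use that flip in auto)
      show "\<not> ?T \<subseteq> b" if " (lower_half m (y - x) \<noteq> h)" "b \<in> ?F3" for b
        unfolding swap unfolding 5 by (rule inf_fam_pq_ex1(2)[OF m(2) _ _ _ _ _ _ x(2,1)]) (use that flip in auto)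
    qed
    then show ?thesis by (rule ex1_block_mono) (use sub cases 5 in auto)
  next
    case 6
    \<comment> \<open>With the constants 1 and -1, the eliminations in \<open>P2\<close> and
      \<open>P3\<close> arrive at the same difference \<open>x - y - 1\<close>; this is where the
      opposite signs matter.\<close>
    have P2: "?P2 x w = (\<not> lower_half m (x - y - 1))" if "m dvd 2 * x - y - 1 - w" for w
    proof -
      have "m dvd (w - x) - (x - y - 1)" using that dvd_diff_swap[of m "2 * x - y - 1" w] by (simp add: algebra_simps)
      then show ?thesis using lower_half_cong by blast
    qed
    have P3: "?P3 y w = lower_half m (x - y - 1)" if "m dvd 2 * y - x - (-1) - w" for w
    proof -
      have "m dvd (y - w) - (x - y - 1)" using that by (simp add: algebra_simps)
      then show ?thesis by (rule lower_half_cong)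
    qed
    have "\<exists>!b. b \<in> ?F2 \<union> ?F3 \<and> ?T \<subseteq> b"
    proof (rule ex1_block_choice[where Q = "lower_half m (x - y - 1) \<noteq> h"])
      show "\<exists>!b. b \<in> ?F2 \<and> ?T \<subseteq> b" if " (lower_half m (x - y - 1) \<noteq> h)"
        unfolding 6 by (rule inf_fam_pr_ex1(1)[where P = ?P2, OF m(2) _ _ _ _ _ _ x P2]) (use that flip in auto)
      show "\<not> ?T \<subseteq> b" if "\<not> (lower_half m (x - y - 1) \<noteq> h)" "b \<in> ?F2" for b
        unfolding 6 by (rule inf_fam_pr_ex1(2)[where P = ?P2, OF m(2) _ _ _ _ _ _ x P2]) (use that flip in auto)
      show "\<exists>!b. b \<in> ?F3 \<and> ?T \<subseteq> b" if "\<not> (lower_half m (x - y - 1) \<noteq> h)"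
        unfolding swap unfolding 6 by (rule inf_fam_pr_ex1(1)[where P = ?P3, OF m(2) _ _ _ _ _ _ x(2,1) P3]) (use that flip in auto)
      show "\<not> ?T \<subseteq> b" if " (lower_half m (x - y - 1) \<noteq> h)" "b \<in> ?F3" for b
        unfolding swap unfolding 6 by (rule inf_fam_pr_ex1(2)[where P = ?P3, OF m(2) _ _ _ _ _ _ x(2,1) P3]) (use that flip in auto)
    qed
    then show ?thesis by (rule ex1_block_mono) (use sub cases 6 in auto)
  qed
qed

subsection \<open>Classification of triples\<close>

definition points :: "int \<Rightarrow> (nat \<times> int) set" where
  "points m = {..<4} \<times> {0..<m} \<union> {(4, 0), (4, 1)}"

text \<open>Names the ingredient responsible for a triple: 0 to 3 for the copies of the given
  system, 4 and 5 for the balanced designs on layers 0, 3 and 1, 2, and 6 for the mixed blocks. The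
  single-layer tests come first, so classes 4 and 5 contain only triples that meet both
  layers.\<close>

definition triple_class :: "(nat \<times> int) set \<Rightarrow> nat" where
  "triple_class T =
     (if fst ` T \<subseteq> {0, 4} then 0 else if fst ` T \<subseteq> {1, 4} then 1
      else if fst ` T \<subseteq> {2, 4} then 2 else if fst ` T \<subseteq> {3, 4} then 3
      else if fst ` T \<subseteq> {0, 3} then 4 else if fst ` T \<subseteq> {1, 2} then 5 else 6)"

lemma triple_class_less: "triple_class T < 7"
  by (simp add: triple_class_def)

lemma nat_less_4_cases: "(i::nat) < 4 \<Longrightarrow> i = 0 \<or> i = 1 \<or> i = 2 \<or> i = 3"
  by auto

lemma triple_class_6_fst:
  assumes "triple_class T = 6"
  shows "\<And>i. i < 4 \<Longrightarrow> \<not> fst ` T \<subseteq> {i, 4}" "\<not> fst ` T \<subseteq> {0, 3}" "\<not> fst ` T \<subseteq> {1, 2}"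
proof -
  show "\<not> fst ` T \<subseteq> {i, 4}" if "i < 4" for i
    using nat_less_4_cases[OF that] assms
    by (elim disjE) (simp_all add: triple_class_def split: if_splits)
  show "\<not> fst ` T \<subseteq> {0, 3}" "\<not> fst ` T \<subseteq> {1, 2}"
    using assms by (simp_all add: triple_class_def split: if_splits)
qed

text \<open>Sorting by the first component puts infinite points last. Class 6 allows at most one of
  them, and what remains is a pair of layers with an infinite point, a repeated layer, or a
  transversal of three layers.\<close>

lemma mixed_ex1:
  assumes m: "even m" "0 < m" and T: "T \<subseteq> points m" "card T = 3" "triple_class T = 6"
  shows "\<exists>!b. b \<in> mixed_blocks m \<and> T \<subseteq> b"
proof -
  obtain a b c where abc: "T = {a, b, c}" "a \<noteq> b" "b \<noteq> c" "a \<noteq> c" "fst a \<le> fst b" "fst b \<le> fst c"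
    by (rule card_3_sorted[OF T(2), of fst])
  obtain i x j y k z where ijk: "a = (i, x)" "b = (j, y)" "c = (k, z)" by (metis surj_pair)
  note T1 = abc[unfolded ijk fst_conv]
  have mem: "(i, x) \<in> points m" "(j, y) \<in> points m" "(k, z) \<in> points m" using T(1) T1(1) by auto
  have le: "k \<le> 4" using mem by (auto simp: points_def)
  have fst: "fst ` T = {i, j, k}" using T1(1) by auto
  note cl = triple_class_6_fst[OF T(3), unfolded fst]
  have i4: "i < 4"
  proof (rule ccontr)
    assume "\<not> i < 4"
    then have "i = 4" "j = 4" "k = 4" using le T1 by auto
    then show False using cl(1)[of 0] by simp
  qed
  \<comment> \<open>Two infinite points and one point of layer \<open>i\<close> would be a triple of
    the copy on that layer.\<close>
  have j4: "j < 4"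
  proof (rule ccontr)
    assume "\<not> j < 4"
    then have "j = 4" "k = 4" using le T1 by auto
    then show False using cl(1)[OF i4] by simp
  qed
  have xy: "x \<in> {0..<m}" "y \<in> {0..<m}" using mem i4 j4 by (auto simp: points_def)
  show ?thesis
  proof (cases "k = 4")
    case True
    then have "z = 0 \<or> z = 1" using mem(3) by (auto simp: points_def)
    then obtain h where h: "z = of_bool h" by (metis of_bool_eq(1,2))
    have "i \<noteq> j" using cl(1)[OF i4] True by auto
    then have "i < j" using T1 by simp
    then have "(i, j) \<in> {(0,1), (0,2), (0,3), (1,2), (1,3), (2,3)}" using j4 by auto
    from mixed_inf_ex1[OF m xy this, of h]
    show ?thesis unfolding T1(1) True h by (simp add: insert_commute)
  next
    case False
    then have k4: "k < 4" using le by simp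
    have z: "z \<in> {0..<m}" using mem(3) k4 by (auto simp: points_def)
    consider "i = j" "j < k" | "i < j" "j = k" | "i < j" "j < k" | "i = j" "j = k" using T1(5,6) by linarith
    then show ?thesis
    proof cases
      case 1
      have "(i, k) \<in> {(0,1), (0,2), (1,0), (1,3), (2,0), (2,3), (3,1), (3,2)}"
        using 1 k4 cl(2,3) nat_less_4_cases[OF i4] nat_less_4_cases[OF k4] by auto
      moreover have "x \<noteq> y" using T1 1 by auto
      ultimately show ?thesis unfolding T1(1) using mixed_pair_ex1[OF m(2) xy z] 1 by simp
    next
      case 2
      have "(k, i) \<in> {(0,1), (0,2), (1,0), (1,3), (2,0), (2,3), (3,1), (3,2)}"
        using 2 k4 cl(2,3) nat_less_4_cases[OF i4] nat_less_4_cases[OF k4] by (auto simp: insert_commute)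
      moreover have "y \<noteq> z" using T1 2 by auto
      moreover have "T = {(k, y), (k, z), (i, x)}" using T1(1) 2 by auto
      ultimately show ?thesis using mixed_pair_ex1[OF m(2) xy(2) z xy(1)] by simp
    next
      case 3
      then consider "i = 0" "j = 1" "k = 2" | "i = 0" "j = 1" "k = 3" | "i = 0" "j = 2" "k = 3" | "i = 1" "j = 2" "k = 3"
        using k4 nat_less_4_cases[OF i4] nat_less_4_cases[OF j4] nat_less_4_cases[OF k4] by auto
      then show ?thesis
      proof cases
        case 1
        show ?thesis unfolding T1(1) by (rule mixed_transversal_ex1[OF m(2) xy z]) (simp add: 1)
      next
        case 2
        \<comment> \<open>The distinguished layer of the family on layers 0, 1, 3 is layer 1, so its
          point is listed first.\<close>
        have "T = {(j, y), (i, x), (k, z)}" using T1(1) by auto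
        then show ?thesis using mixed_transversal_ex1[OF m(2) xy(2,1) z, of j i k] 2 by simp
      next
        case 3
        have "T = {(j, y), (i, x), (k, z)}" using T1(1) by auto
        then show ?thesis using mixed_transversal_ex1[OF m(2) xy(2,1) z, of j i k] 3 by simp
      next
        case 4
        have "T = {(k, z), (i, x), (j, y)}" using T1(1) by auto
        then show ?thesis using mixed_transversal_ex1[OF m(2) z xy, of k i j] 4 by simp
      qed
    next
      case 4
      then show ?thesis using cl(1)[OF i4] by simp
    qed
  qed
qed

section \<open>Mixed blocks contain only triples of class 6\<close>

lemma triple_class_4_points:
  assumes "T \<subseteq> {a, b, c, d}" "card T = 3"
    and "6 = triple_class {a, b, c}" "6 = triple_class {a, b, d}" "6 = triple_class {a, c, d}" "6 = triple_class {b, c, d}"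
  shows "triple_class T = 6"
  using card_3_subset_of_4[OF assms(1,2)] assms(3-) by auto

lemma double_fam_block:
  assumes "b \<in> double_fam m p q r c" "(p, q, r) \<in> {(0,1,2), (1,0,3), (2,0,3), (3,1,2)}"
  shows "b \<subseteq> points m" "card b = 4" "\<lbrakk>T \<subseteq> b; card T = 3\<rbrakk> \<Longrightarrow> triple_class T = 6"
proof -
  obtain x x' y z where b: "b = {(p, x), (p, x'), (q, y), (r, z)}" "x \<noteq> x'"
    "x \<in> {0..<m}" "x' \<in> {0..<m}" "y \<in> {0..<m}" "z \<in> {0..<m}"
    using assms(1) unfolding double_fam_def by blast
  have d: "p \<noteq> q" "p \<noteq> r" "q \<noteq> r" "p < 4" "q < 4" "r < 4" using assms(2) by auto
  show "b \<subseteq> points m" using b d by (auto simp: points_def)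
  show "card b = 4" using b(1,2) d by auto
  assume T: "T \<subseteq> b" "card T = 3"
  show "triple_class T = 6"
    using T(1) unfolding b(1)
  proof (rule triple_class_4_points[OF _ T(2)])
    from assms(2) consider "p = 0" "q = 1" "r = 2" | "p = 1" "q = 0" "r = 3" | "p = 2" "q = 0" "r = 3" | "p = 3" "q = 1" "r = 2"
      by auto
    note cs = this
    show "6 = triple_class {(p, x), (p, x'), (q, y)}" using cs by cases (simp_all add: triple_class_def)
    show "6 = triple_class {(p, x), (p, x'), (r, z)}" using cs by cases (simp_all add: triple_class_def)
    show "6 = triple_class {(p, x), (q, y), (r, z)}" using cs by cases (simp_all add: triple_class_def)
    show "6 = triple_class {(p, x'), (q, y), (r, z)}" using cs by cases (simp_all add: triple_class_def)
  qed
qed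

lemma inf_fam_block:
  assumes "b \<in> inf_fam m p q r c P" "(p, q, r) \<in> {(0,1,2), (1,0,3), (2,0,3), (3,1,2)}"
  shows "b \<subseteq> points m" "card b = 4" "\<lbrakk>T \<subseteq> b; card T = 3\<rbrakk> \<Longrightarrow> triple_class T = 6"
proof -
  obtain x y z where b: "b = {(4, of_bool (P x y)), (p, x), (q, y), (r, z)}"
    "x \<in> {0..<m}" "y \<in> {0..<m}" "z \<in> {0..<m}"
    using assms(1) unfolding inf_fam_def by blast
  have d: "p \<noteq> q" "p \<noteq> r" "q \<noteq> r" "p < 4" "q < 4" "r < 4" using assms(2) by auto
  show "b \<subseteq> points m" using b d by (auto simp: points_def)
  show "card b = 4" using b(1) d by auto
  assume T: "T \<subseteq> b" "card T = 3"
  show "triple_class T = 6"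
    using T(1) unfolding b(1)
  proof (rule triple_class_4_points[OF _ T(2)])
    from assms(2) consider "p = 0" "q = 1" "r = 2" | "p = 1" "q = 0" "r = 3" | "p = 2" "q = 0" "r = 3" | "p = 3" "q = 1" "r = 2"
      by auto
    note cs = this
    show "6 = triple_class {(4, of_bool (P x y)), (p, x), (q, y)}" using cs by cases (simp_all add: triple_class_def)
    show "6 = triple_class {(4, of_bool (P x y)), (p, x), (r, z)}" using cs by cases (simp_all add: triple_class_def)
    show "6 = triple_class {(4, of_bool (P x y)), (q, y), (r, z)}" using cs by cases (simp_all add: triple_class_def)
    show "6 = triple_class {(p, x), (q, y), (r, z)}" using cs by cases (simp_all add: triple_class_def)
  qed
qed

lemma mixed_block:
  assumes "b \<in> mixed_blocks m"
  shows "b \<subseteq> points m" "card b = 4" "\<lbrakk>T \<subseteq> b; card T = 3\<rbrakk> \<Longrightarrow> triple_class T = 6"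
proof -
  show "b \<subseteq> points m"
    using assms
  proof (cases rule: mixed_blocksE)
    case D0 from double_fam_block(1)[OF this] show ?thesis by simp
  next
    case D1 from double_fam_block(1)[OF this] show ?thesis by simp
  next
    case D2 from double_fam_block(1)[OF this] show ?thesis by simp
  next
    case D3 from double_fam_block(1)[OF this] show ?thesis by simp
  next
    case I0 from inf_fam_block(1)[OF this] show ?thesis by simp
  next
    case I1 from inf_fam_block(1)[OF this] show ?thesis by simp
  next
    case I2 from inf_fam_block(1)[OF this] show ?thesis by simp
  next
    case I3 from inf_fam_block(1)[OF this] show ?thesis by simp
  qed
  show "card b = 4"
    using assms
  proof (cases rule: mixed_blocksE)
    case D0 from double_fam_block(2)[OF this] show ?thesis by simp
  next
    case D1 from double_fam_block(2)[OF this] show ?thesis by simp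
  next
    case D2 from double_fam_block(2)[OF this] show ?thesis by simp
  next
    case D3 from double_fam_block(2)[OF this] show ?thesis by simp
  next
    case I0 from inf_fam_block(2)[OF this] show ?thesis by simp
  next
    case I1 from inf_fam_block(2)[OF this] show ?thesis by simp
  next
    case I2 from inf_fam_block(2)[OF this] show ?thesis by simp
  next
    case I3 from inf_fam_block(2)[OF this] show ?thesis by simp
  qed
  show "triple_class T = 6" if "T \<subseteq> b" "card T = 3"
    using assms
  proof (cases rule: mixed_blocksE)
    case D0 from double_fam_block(3)[OF this _ that] show ?thesis by simp
  next
    case D1 from double_fam_block(3)[OF this _ that] show ?thesis by simp
  next
    case D2 from double_fam_block(3)[OF this _ that] show ?thesis by simp
  next
    case D3 from double_fam_block(3)[OF this _ that] show ?thesis by simp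
  next
    case I0 from inf_fam_block(3)[OF this _ that] show ?thesis by simp
  next
    case I1 from inf_fam_block(3)[OF this _ that] show ?thesis by simp
  next
    case I2 from inf_fam_block(3)[OF this _ that] show ?thesis by simp
  next
    case I3 from inf_fam_block(3)[OF this _ that] show ?thesis by simp
  qed
qed

subsection \<open>Assembling the system\<close>

lemma embeds_trans: "embeds X B Y C \<Longrightarrow> embeds Y C Z D \<Longrightarrow> embeds X B Z D"
proof -
  assume "embeds X B Y C"
  then obtain f where f: "inj_on f X" "f ` X \<subseteq> Y" "(`) f ` B \<subseteq> C" unfolding embeds_def by (elim exE conjE)
  assume "embeds Y C Z D"
  then obtain g where g: "inj_on g Y" "g ` Y \<subseteq> Z" "(`) g ` C \<subseteq> D" unfolding embeds_def by (elim exE conjE)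
  have "inj_on (g \<circ> f) X" using f g by (meson comp_inj_on inj_on_subset)
  moreover have "(g \<circ> f) ` X \<subseteq> Z" using f(2) g(2) unfolding image_comp[symmetric] by blast
  moreover have "(`) (g \<circ> f) ` B \<subseteq> D" using f(3) g(3) unfolding image_subset_iff image_comp[symmetric] by blast
  ultimately show ?thesis unfolding embeds_def by blast
qed

text \<open>Only the group sizes matter: bijections between the corresponding groups combine into
  one injection that carries the design to any disjoint sets of these sizes.\<close>

lemma BBD3_relocate:
  assumes D: "BBD3 Y g1 g2 C" and h: "finite h1" "finite h2" "h1 \<inter> h2 = {}" "card h1 = card g1" "card h2 = card g2"
  obtains E where "BBD3 (h1 \<union> h2) h1 h2 E" "embeds Y C (h1 \<union> h2) E"
proof -
  have g: "g1 \<union> g2 = Y" "g1 \<inter> g2 = {}" "finite Y" using D by (auto simp: BBD3_def)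
  then have fin: "finite g1" "finite g2" by auto
  obtain f1 f2 where f: "bij_betw f1 g1 h1" "bij_betw f2 g2 h2"
    using finite_same_card_bij[OF fin(1) h(1)] finite_same_card_bij[OF fin(2) h(2)] h by metis
  define f where "f y = (if y \<in> g1 then f1 y else f2 y)" for y
  have "bij_betw f g1 h1" using f(1) by (subst bij_betw_cong[of _ f f1]) (auto simp: f_def)
  moreover have "bij_betw f g2 h2" using f(2) g(2) by (subst bij_betw_cong[of _ f f2]) (auto simp: f_def)
  ultimately have *: "bij_betw f Y (h1 \<union> h2)" "f ` g1 = h1" "f ` g2 = h2"
    using bij_betw_combine[of f g1 h1 g2 h2] h(3) g(1) by (auto simp: bij_betw_def)
  then have inj: "inj_on f Y" and im: "f ` Y = h1 \<union> h2" by (auto simp: bij_betw_def)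
  show thesis
  proof
    show "BBD3 (h1 \<union> h2) h1 h2 ((`) f ` C)" using BBD3_image[OF D inj] im * by simp
    show "embeds Y C (h1 \<union> h2) ((`) f ` C)" unfolding embeds_def using inj im by blast
  qed
qed

lemma BBD3_card: "BBD3 Y g1 g2 C \<Longrightarrow> card Y = 2 * card g1"
proof -
  assume D: "BBD3 Y g1 g2 C"
  then have g: "g1 \<union> g2 = Y" "g1 \<inter> g2 = {}" "card g1 = card g2" "finite Y" by (auto simp: BBD3_def)
  then have "card (g1 \<union> g2) = card g1 + card g2" by (intro card_Un_disjoint) auto
  then show ?thesis using g by simp
qed

text \<open>A block has only two points in each group, so three of its points cannot avoid the other
  group. This gives the triples of blocks on two layers the class 4 or 5.\<close>

lemma BBD3_block_meets:
  assumes D: "BBD3 Y g1 g2 C" and b: "b \<in> C" "T \<subseteq> b" "card T = 3"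
  shows "T \<inter> g1 \<noteq> {}" "T \<inter> g2 \<noteq> {}"
proof -
  have *: "b \<subseteq> g1 \<union> g2" "card (b \<inter> g1) = 2" "card (b \<inter> g2) = 2" using D b(1) by (auto simp: BBD3_def)
  then have fin: "finite (b \<inter> g1)" "finite (b \<inter> g2)" by (auto intro: card_ge_0_finite)
  show "T \<inter> g1 \<noteq> {}"
  proof
    assume "T \<inter> g1 = {}"
    then have "T \<subseteq> b \<inter> g2" using b * by blast
    then show False using card_mono[OF fin(2), of T] *(3) b(3) by simp
  qed
  show "T \<inter> g2 \<noteq> {}"
  proof
    assume "T \<inter> g2 = {}"
    then have "T \<subseteq> b \<inter> g1" using b * by blast
    then show False using card_mono[OF fin(1), of T] *(2) b(3) by simp
  qed
qed

section \<open>Triples inside one or two layers\<close>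

abbreviation layer :: "int \<Rightarrow> nat \<Rightarrow> (nat \<times> int) set" where
  "layer m i \<equiv> {i} \<times> {0..<m}"

lemma triple_class_layer_inf:
  assumes i: "i < 4" and T: "T \<subseteq> layer m i \<union> {(4, 0), (4, 1)}" "card T = 3"
  shows "triple_class T = i"
proof -
  have sub: "fst ` T \<subseteq> {i, 4}" using T(1) by auto
  \<comment> \<open>There are only two infinite points, so a triple reaches the layer
    itself.\<close>
  have "\<not> fst ` T \<subseteq> {4}"
  proof
    assume "fst ` T \<subseteq> {4}"
    then have "T \<subseteq> {(4, 0), (4, 1)}" using T(1) i by fastforce
    then have "card T \<le> card {(4::nat, 0::int), (4, 1)}" by (intro card_mono) auto
    then show False using T(2) by simp
  qed
  then have "i \<in> fst ` T" using sub by blast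
  then show ?thesis using sub nat_less_4_cases[OF i] unfolding triple_class_def
    by (elim disjE) auto
qed

lemma fst_image_layers:
  assumes T: "T \<subseteq> layer m i \<union> layer m j" "T \<inter> layer m i \<noteq> {}" "T \<inter> layer m j \<noteq> {}"
  shows "fst ` T = {i, j}"
  using assms by force

lemma subset_layer_inf:
  assumes T: "T \<subseteq> points m" "triple_class T = i" "i < 4"
  shows "T \<subseteq> layer m i \<union> {(4, 0), (4, 1)}"
proof -
  have "fst ` T \<subseteq> {i, 4}" using T(2,3) by (auto simp: triple_class_def split: if_splits)
  then show ?thesis using T(1,3) by (fastforce simp: points_def)
qed

lemma subset_two_layers:
  assumes T: "T \<subseteq> points m" "fst ` T \<subseteq> {i, j}" "\<not> fst ` T \<subseteq> {i, 4}" "\<not> fst ` T \<subseteq> {j, 4}" and ij: "i < 4" "j < 4"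
  shows "T \<subseteq> layer m i \<union> layer m j" "T \<inter> layer m i \<noteq> {}" "T \<inter> layer m j \<noteq> {}"
proof -
  show sub: "T \<subseteq> layer m i \<union> layer m j"
  proof
    fix t assume t: "t \<in> T"
    then have "t \<in> points m" "fst t \<in> {i, j}" using T by auto
    then show "t \<in> layer m i \<union> layer m j" using ij by (cases t) (auto simp: points_def)
  qed
  show "T \<inter> layer m i \<noteq> {}"
  proof
    assume "T \<inter> layer m i = {}"
    then have "T \<subseteq> layer m j" using sub by blast
    then show False using T(4) by auto
  qed
  show "T \<inter> layer m j \<noteq> {}"
  proof
    assume "T \<inter> layer m j = {}"
    then have "T \<subseteq> layer m i" using sub by blast
    then show False using T(3) by auto
  qed
qed

text \<open>If the blocks of \<open>F k\<close> contain only triples of class \<open>k\<close>, then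
  all blocks through \<open>T\<close> come from the family of its own class, and coverage can be
  checked class by class.\<close>

lemma ex1_block_glue:
  assumes "\<kappa> T \<in> I" "\<exists>!b. b \<in> F (\<kappa> T) \<and> T \<subseteq> b"
    and "\<And>k b. \<lbrakk>k \<in> I; b \<in> F k; T \<subseteq> b\<rbrakk> \<Longrightarrow> \<kappa> T = k"
  shows "\<exists>!b. b \<in> (\<Union>k\<in>I. F k) \<and> T \<subseteq> b"
proof (rule ex1_block_mono[OF assms(2)])
  show "F (\<kappa> T) \<subseteq> (\<Union>k\<in>I. F k)" using assms(1) by blast
  fix b assume "b \<in> (\<Union>k\<in>I. F k)" "T \<subseteq> b"
  then obtain k where "k \<in> I" "b \<in> F k" by blast
  then show "b \<in> F (\<kappa> T)" using assms(3) \<open>T \<subseteq> b\<close> by simp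
qed

text \<open>Each ingredient covers exactly the triples of its class, so their union is a Steiner
  system. The four copies of the given system share the infinite points without conflict, because
  every triple inside a copy has a point in its layer.\<close>

lemma quadrupling_construction:
  fixes X :: "'a set" and Y :: "'b set"
  assumes K: "4 \<in> K" and S: "steiner3 K X B" "card X = 2 * n + 2"
    and D: "BBD3 Y g1 g2 C" "card Y = n" and n: "0 < n"
  obtains E where "steiner3 K (points (2 * int n)) E" "embeds X B (points (2 * int n)) E"
    "embeds Y C (points (2 * int n)) E"
proof -
  define m where "m = 2 * int n"
  have m: "even m" "0 < m" using n by (auto simp: m_def)
  have card_layer: "card (layer m i) = 2 * n" for i by (simp add: m_def card_cartesian_product)
  have layer_sub: "layer m i \<subseteq> points m" if "i < 4" for i using that by (auto simp: points_def)
  have finX: "finite X" using S by (simp add: steiner3_def)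
  let ?L = "\<lambda>i. layer m i \<union> {(4, 0), (4, 1)}"
  have "\<exists>f. bij_betw f X (?L i)" if "i < 4" for i
  proof (rule finite_same_card_bij[OF finX])
    have "layer m i \<inter> {(4, 0), (4, 1)} = {}" using that by auto
    then have "card (?L i) = card (layer m i) + card {(4::nat, 0::int), (4, 1)}"
      by (intro card_Un_disjoint) auto
    then show "card X = card (?L i)" using S(2) card_layer by simp
  qed auto
  then obtain f where f: "\<And>i. i < 4 \<Longrightarrow> bij_betw (f i) X (?L i)" by metis
  have steiner: "steiner3 K (?L i) ((`) (f i) ` B)" if "i < 4" for i
    using steiner3_image[OF S(1), of "f i"] f[OF that] by (auto simp: bij_betw_def)
  \<comment> \<open>The given groups have \<open>n div 2\<close> points; two doublings raise this to
    \<open>2 * n\<close>, the size of a layer.\<close>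
  obtain C1 where C1: "BBD3 (UNIV \<times> Y) (UNIV \<times> g1) (UNIV \<times> g2) (C1 :: (bool \<times> 'b) set set)"
    "embeds Y C (UNIV \<times> Y) C1" by (rule BBD3_double[OF D(1)])
  obtain C2 where C2: "BBD3 (UNIV \<times> UNIV \<times> Y) (UNIV \<times> UNIV \<times> g1) (UNIV \<times> UNIV \<times> g2) (C2 :: (bool \<times> bool \<times> 'b) set set)"
    "embeds (UNIV \<times> Y) C1 (UNIV \<times> UNIV \<times> Y) C2" by (rule BBD3_double[OF C1(1)])
  have card_g: "card ((UNIV :: bool set) \<times> (UNIV :: bool set) \<times> g1) = 2 * n" "card ((UNIV :: bool set) \<times> (UNIV :: bool set) \<times> g2) = 2 * n"
    using BBD3_card[OF D(1)] D by (auto simp: card_cartesian_product BBD3_def)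
  have rel: thesis' if "i \<noteq> j" "\<And>E. BBD3 (layer m i \<union> layer m j) (layer m i) (layer m j) E \<Longrightarrow>
      embeds (UNIV \<times> UNIV \<times> Y) C2 (layer m i \<union> layer m j) E \<Longrightarrow> thesis'" for i j thesis'
    by (rule BBD3_relocate[OF C2(1), of "layer m i" "layer m j"]) (use that card_g card_layer in auto)
  obtain E03 where E03: "BBD3 (layer m 0 \<union> layer m 3) (layer m 0) (layer m 3) E03"
    "embeds (UNIV \<times> UNIV \<times> Y) C2 (layer m 0 \<union> layer m 3) E03" by (rule rel[of 0 3]) auto
  obtain E12 where E12: "BBD3 (layer m 1 \<union> layer m 2) (layer m 1) (layer m 2) E12" by (rule rel[of 1 2]) auto
  \<comment> \<open>The indices agree with the values of \<open>triple_class\<close>.\<close>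
  define F where "F k = (if k < 4 then (`) (f k) ` B else if k = 4 then E03 else if k = 5 then E12
    else mixed_blocks m)" for k :: nat
  have F_simps: "F 4 = E03" "F 5 = E12" "F 6 = mixed_blocks m" "\<And>k. k < 4 \<Longrightarrow> F k = (`) (f k) ` B"
    by (auto simp: F_def)
  have k7: "k < 4 \<or> k = 4 \<or> k = 5 \<or> k = 6" if "k < 7" for k :: nat using that by auto
  let ?E = "\<Union>k\<in>{..<7}. F k"
  have block: "b \<subseteq> points m \<and> card b \<in> K" if "k < 7" "b \<in> F k" for k b
    using k7[OF that(1)]
  proof (elim disjE)
    assume k: "k < 4"
    then have "b \<subseteq> ?L k" "card b \<in> K" using steiner[OF k] that(2) by (auto simp: F_simps steiner3_def)
    then show ?thesis using layer_sub[OF k] by (auto simp: points_def)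
  next
    assume "k = 4"
    then have "b \<in> E03" using that(2) by (simp add: F_simps)
    then have "b \<subseteq> layer m 0 \<union> layer m 3 \<and> card b = 4" using E03(1) unfolding BBD3_def by simp
    then show ?thesis using layer_sub[of 0] layer_sub[of 3] K by auto
  next
    assume "k = 5"
    then have "b \<in> E12" using that(2) by (simp add: F_simps)
    then have "b \<subseteq> layer m 1 \<union> layer m 2 \<and> card b = 4" using E12(1) unfolding BBD3_def by simp
    then show ?thesis using layer_sub[of 1] layer_sub[of 2] K by auto
  next
    assume "k = 6"
    then show ?thesis using mixed_block(1,2)[of b m] that(2) K by (simp add: F_simps)
  qed
  have cls: "triple_class T = k" if "k < 7" "b \<in> F k" "T \<subseteq> b" "card T = 3" for k b T
    using k7[OF that(1)]
  proof (elim disjE)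
    assume k: "k < 4"
    then have "b \<subseteq> ?L k" using steiner[OF k] that(2) by (auto simp: F_simps steiner3_def)
    then show ?thesis using triple_class_layer_inf[OF k] that by blast
  next
    assume k: "k = 4"
    have b: "b \<in> E03" using that(2) k by (simp add: F_simps)
    then have "b \<subseteq> layer m 0 \<union> layer m 3" using E03(1) unfolding BBD3_def by simp
    with that(3) have "T \<subseteq> layer m 0 \<union> layer m 3" by (rule subset_trans)
    then have "fst ` T = {0, 3}" using BBD3_block_meets[OF E03(1) b that(3,4)] by (rule fst_image_layers)
    then show ?thesis using k by (simp add: triple_class_def)
  next
    assume k: "k = 5"
    have b: "b \<in> E12" using that(2) k by (simp add: F_simps)
    then have "b \<subseteq> layer m 1 \<union> layer m 2" using E12(1) unfolding BBD3_def by simp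
    with that(3) have "T \<subseteq> layer m 1 \<union> layer m 2" by (rule subset_trans)
    then have "fst ` T = {1, 2}" using BBD3_block_meets[OF E12(1) b that(3,4)] by (rule fst_image_layers)
    then show ?thesis using k by (simp add: triple_class_def)
  next
    assume "k = 6"
    then show ?thesis using mixed_block(3) that(2-4) by (auto simp: F_simps)
  qed
  have ex1: "\<exists>!b. b \<in> F (triple_class T) \<and> T \<subseteq> b" if T: "T \<subseteq> points m" "card T = 3" for T
    using k7[OF triple_class_less[of T]]
  proof (elim disjE)
    assume k: "triple_class T < 4"
    show ?thesis unfolding F_simps(4)[OF k]
      using steiner[OF k] subset_layer_inf[OF T(1) refl k] T(2) by (simp add: steiner3_def)
  next
    assume k: "triple_class T = 4"
    then have "fst ` T \<subseteq> {0, 3}" "\<not> fst ` T \<subseteq> {0, 4}" "\<not> fst ` T \<subseteq> {3, 4}"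
      by (simp_all add: triple_class_def split: if_splits)
    from subset_two_layers[OF T(1) this]
    show ?thesis unfolding k F_simps by (intro BBD3_ex1[OF E03(1) _ T(2)]) simp_all
  next
    assume k: "triple_class T = 5"
    then have "fst ` T \<subseteq> {1, 2}" "\<not> fst ` T \<subseteq> {1, 4}" "\<not> fst ` T \<subseteq> {2, 4}"
      by (simp_all add: triple_class_def split: if_splits)
    from subset_two_layers[OF T(1) this]
    show ?thesis unfolding k F_simps by (intro BBD3_ex1[OF E12(1) _ T(2)]) simp_all
  next
    assume k: "triple_class T = 6"
    show ?thesis unfolding k F_simps by (rule mixed_ex1[OF m T k])
  qed
  have "steiner3 K (points m) ?E" unfolding steiner3_def
  proof (intro conjI ballI allI impI)
    show "finite (points m)" by (simp add: points_def)
  next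
    fix b assume "b \<in> ?E"
    then show "b \<subseteq> points m" "card b \<in> K" using block by blast+
  next
    fix T assume T: "T \<subseteq> points m \<and> card T = 3"
    show "\<exists>!b. b \<in> ?E \<and> T \<subseteq> b"
      by (rule ex1_block_glue[of triple_class]) (use T ex1 cls triple_class_less in auto)
  qed
  moreover have "embeds X B (points m) ?E" unfolding embeds_def
  proof (intro exI[of _ "f 0"] conjI)
    show "inj_on (f 0) X" using f[of 0] by (simp add: bij_betw_def)
    show "f 0 ` X \<subseteq> points m" using f[of 0] layer_sub[of 0] by (auto simp: bij_betw_def points_def)
    show "(`) (f 0) ` B \<subseteq> ?E" using F_simps(4)[of 0] by force
  qed
  moreover have "embeds (UNIV \<times> UNIV \<times> Y) C2 (points m) ?E"
  proof -
    have "layer m 0 \<union> layer m 3 \<subseteq> points m" using layer_sub by simp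
    moreover have "E03 \<subseteq> ?E" using F_simps(1) by force
    ultimately show ?thesis using E03(2) unfolding embeds_def by (meson subset_trans)
  qed
  \<comment> \<open>The given balanced design sits in its first double, that one in the second, and
    the second in the design on layers 0 and 3.\<close>
  then have "embeds Y C (points m) ?E" using C1(2) C2(2) embeds_trans by metis
  ultimately show thesis using that unfolding m_def by blast
qed

section \<open>Number of points and transport to the natural numbers\<close>

lemma card_points: "card (points (2 * int n)) = 8 * n + 2"
proof -
  have "card (points (2 * int n)) = card ({..<4::nat} \<times> {0..<2 * int n}) + card {(4::nat, 0::int), (4, 1)}"
    unfolding points_def by (intro card_Un_disjoint) auto
  then show ?thesis by (simp add: card_cartesian_product)
qed

lemma quadrupling_exists:
  assumes "4 \<in> K" "steiner3 K X B" "card X = 2 * n + 2" "BBD3 Y g1 g2 C" "card Y = n" "0 < n"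
  shows "\<exists>(Z :: nat set) D. steiner3 K Z D \<and> card Z = 8 * n + 2 \<and> embeds X B Z D \<and> embeds Y C Z D"
proof -
  let ?P = "points (2 * int n)"
  obtain E where E: "steiner3 K ?P E" "embeds X B ?P E" "embeds Y C ?P E"
    using quadrupling_construction[OF assms] by metis
  have "finite ?P" by (simp add: points_def)
  then obtain h :: "nat \<times> int \<Rightarrow> nat" where h: "inj_on h ?P"
    using finite_imp_inj_to_nat_seg by metis
  have "embeds ?P E (h ` ?P) ((`) h ` E)" unfolding embeds_def using h by blast
  moreover have "card (h ` ?P) = 8 * n + 2" using h card_points by (simp add: card_image)
  ultimately show ?thesis using steiner3_image[OF E(1) h] E embeds_trans by metis
qed

theorem theorem2:
  fixes n :: nat
  assumes "even n" and "n > 75"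
  shows "(\<forall>(X::'a set) B (Y::'b set) g1 g2 C.
            SQS X B \<and> card X = 2*n+2 \<and> BBD3 Y g1 g2 C \<and> card Y = n \<longrightarrow>
            (\<exists>(Z::nat set) D. SQS Z D \<and> card Z = 8*n+2 \<and> embeds X B Z D \<and> embeds Y C Z D))
       \<and> (\<forall>(X::'a set) B (Y::'b set) g1 g2 C.
            S346 X B \<and> card X = 2*n+2 \<and> BBD3 Y g1 g2 C \<and> card Y = n \<longrightarrow>
            (\<exists>(Z::nat set) D. S346 Z D \<and> card Z = 8*n+2 \<and> embeds X B Z D \<and> embeds Y C Z D))"
  unfolding SQS_iff_steiner3 S346_iff_steiner3
proof (intro conjI allI impI; elim conjE)
  fix X :: "'a set" and B and Y :: "'b set" and g1 g2 C
  assume "card X = 2 * n + 2" "BBD3 Y g1 g2 C" "card Y = n"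
  note * = this
  have n: "0 < n" using assms by simp
  show "\<exists>(Z::nat set) D. steiner3 {4} Z D \<and> card Z = 8*n+2 \<and> embeds X B Z D \<and> embeds Y C Z D"
    if "steiner3 {4} X B" using quadrupling_exists[OF _ that * n] by simp
  show "\<exists>(Z::nat set) D. steiner3 {4, 6} Z D \<and> card Z = 8*n+2 \<and> embeds X B Z D \<and> embeds Y C Z D"
    if "steiner3 {4, 6} X B" using quadrupling_exists[OF _ that * n] by simp
qed

end
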